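(* Let $U(\mathbb{Z})$ be the abelian group $K_0(\phi\text{-}\mathrm{end}_{\mathrm{ff}\,\mathbb{Z}})$. Then for every element $a\in U(\mathbb{Z})$ there exist a simply-connected finite CW complex $X$ and a self-map $f\colon X\to X$ such that $u^{\mathbb{Z}}(X,f)=a$.
   Context: $U(\mathbb{Z})$ is the Grothendieck group of endomorphisms of finitely generated free $\mathbb{Z}$-modules; concretely, it is the abelian group generated by symbols $[A]$, for $A$ a square matrix with entries in $\mathbb{Z}$ (of any size), subject to the relations: - $[A]=[B]+[D]$ whenever $A=\begin{pmatrix}B&C\\0&D\end{pmatrix}$ with $B,D$ square; - $[UAU^{-1}]=[A]$ whenever $U$ is a matrix invertible over $\mathbb{Z}$ of the same size as $A$. For a simply-connected finite CW complex $X$ and a self-map $f\colon X\to X$, the group in which the universal (non-equivariant) functorial Lefschetz invariant of $(X,f)$ takes values is canonically identified with $U(\mathbb{Z})$, and the invariant is $$u^{\mathbb{Z}}(X,f)=\sum_{p\ge0}(-1)^p\,[C_p(f)]\in U(\mathbb{Z}),$$ where $C_p(f)$ is the integer matrix of the endomorphism induced by $f$ (after replacing $f$ by a homotopic cellular map) on the $p$-th cellular chain group $C_p(X)$, which is a finitely generated free $\mathbb{Z}$-module with basis given by the $p$-cells. *)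

theory Defs
  imports "HOL-Homology.Homology" "Jordan_Normal_Form.Matrix"
begin

section \<open>The group $U(\mathbb{Z})$\<close>

text \<open>Matrices of size $0 \times 0$ (endomorphisms of the zero module) are allowed as generators;
  the block relation makes their class trivial.\<close>

definition square_int_mats :: "int mat set" where
  "square_int_mats = {A. square_mat A}"

definition block_relators :: "(int mat \<Rightarrow>\<^sub>0 int) set" where
  "block_relators =
     {frag_of (four_block_mat B C (0\<^sub>m m n) D) - (frag_of B + frag_of D) | B C D m n.
        B \<in> carrier_mat n n \<and> C \<in> carrier_mat n m \<and> D \<in> carrier_mat m m}"

text \<open>\<open>similar_mat A' A\<close> over \<open>int\<close> means $A' = U A U^{-1}$ with $U$ invertible over $\mathbb{Z}$.\<close>

definition conjugation_relators :: "(int mat \<Rightarrow>\<^sub>0 int) set" where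
  "conjugation_relators = {frag_of A' - frag_of A | A' A. similar_mat A' A}"

definition relation_subgroup :: "(int mat \<Rightarrow>\<^sub>0 int) set" where
  "relation_subgroup =
     generate (free_Abelian_group square_int_mats) (block_relators \<union> conjugation_relators)"

definition U_Z :: "(int mat \<Rightarrow>\<^sub>0 int) set monoid" where
  "U_Z = free_Abelian_group square_int_mats Mod relation_subgroup"

definition mat_class :: "int mat \<Rightarrow> (int mat \<Rightarrow>\<^sub>0 int) set" where
  "mat_class A = relation_subgroup #>\<^bsub>free_Abelian_group square_int_mats\<^esub> frag_of A"


section \<open>Finite CW complexes\<close>

definition disc :: "nat \<Rightarrow> (nat \<Rightarrow> real) topology" where
  "disc p = subtopology (Euclidean_space p) {x. (\<Sum>i<p. (x i)\<^sup>2) \<le> 1}"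

definition disc_interior :: "nat \<Rightarrow> (nat \<Rightarrow> real) set" where
  "disc_interior p = {x \<in> topspace (Euclidean_space p). (\<Sum>i<p. (x i)\<^sup>2) < 1}"

definition disc_boundary :: "nat \<Rightarrow> (nat \<Rightarrow> real) set" where
  "disc_boundary p = {x \<in> topspace (Euclidean_space p). (\<Sum>i<p. (x i)\<^sup>2) = 1}"

text \<open>The \<open>p\<close>-cells are numbered \<open>0, \<dots>, num_cells X p - 1\<close>, and \<open>char_map X p i\<close> is the
  characteristic map of the \<open>i\<close>-th one, defined on \<open>disc p\<close>.\<close>

record 'a cw =
  cw_space :: "'a topology"
  num_cells :: "nat \<Rightarrow> nat"
  char_map :: "nat \<Rightarrow> nat \<Rightarrow> (nat \<Rightarrow> real) \<Rightarrow> 'a"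

definition open_cell :: "'a cw \<Rightarrow> nat \<Rightarrow> nat \<Rightarrow> 'a set" where
  "open_cell X p i = char_map X p i ` disc_interior p"

text \<open>The index is an integer so that \<open>skeleton X (-1) = {}\<close>.\<close>

definition skeleton :: "'a cw \<Rightarrow> int \<Rightarrow> 'a set" where
  "skeleton X k = (\<Union>p \<in> {p. int p \<le> k}. \<Union>i<num_cells X p. open_cell X p i)"

text \<open>The usual intrinsic definition.  With finitely many cells the closure-finiteness and
  weak topology axioms hold automatically, and are therefore not listed.\<close>

definition finite_CW_complex :: "'a cw \<Rightarrow> bool" where
  "finite_CW_complex X \<longleftrightarrow>
     Hausdorff_space (cw_space X) \<and>
     finite {p. num_cells X p \<noteq> 0} \<and>
     topspace (cw_space X) = (\<Union>p. \<Union>i<num_cells X p. open_cell X p i) \<and>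
     (\<forall>p i q j. i < num_cells X p \<and> j < num_cells X q \<and> (p, i) \<noteq> (q, j) \<longrightarrow>
        open_cell X p i \<inter> open_cell X q j = {}) \<and>
     (\<forall>p. \<forall>i<num_cells X p.
        continuous_map (disc p) (cw_space X) (char_map X p i) \<and>
        homeomorphic_map (subtopology (disc p) (disc_interior p))
          (subtopology (cw_space X) (open_cell X p i)) (char_map X p i) \<and>
        char_map X p i ` disc_boundary p \<subseteq> skeleton X (int p - 1))"

definition simply_connected_space :: "'a topology \<Rightarrow> bool" where
  "simply_connected_space X \<longleftrightarrow>
     topspace X \<noteq> {} \<and> path_connected_space X \<and>
     (\<forall>x \<in> topspace X. \<forall>c. pathin X c \<and> c 0 = x \<and> c 1 = x \<longrightarrow>
        homotopic_with (\<lambda>d. d 0 = x \<and> d 1 = x) (top_of_set {0..1}) X c (\<lambda>t. x))"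

definition cellular_map :: "'a cw \<Rightarrow> ('a \<Rightarrow> 'a) \<Rightarrow> bool" where
  "cellular_map X g \<longleftrightarrow>
     continuous_map (cw_space X) (cw_space X) g \<and>
     (\<forall>p. g ` skeleton X p \<subseteq> skeleton X p)"


section \<open>The cellular chain groups\<close>

definition cell_chain_group :: "'a cw \<Rightarrow> nat \<Rightarrow> 'a chain set monoid" where
  "cell_chain_group X p =
     relative_homology_group (int p)
       (subtopology (cw_space X) (skeleton X (int p))) (skeleton X (int p - 1))"

definition cell_chain_map :: "'a cw \<Rightarrow> nat \<Rightarrow> ('a \<Rightarrow> 'a) \<Rightarrow> 'a chain set \<Rightarrow> 'a chain set" where
  "cell_chain_map X p g =
     hom_induced (int p)
       (subtopology (cw_space X) (skeleton X (int p))) (skeleton X (int p - 1))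
       (subtopology (cw_space X) (skeleton X (int p))) (skeleton X (int p - 1)) g"

text \<open>A generator of the infinite cyclic group $H_p(D^p, S^{p-1})$.  The opposite choice changes
  the sign of all the elements \<open>cell_generator X p i\<close> of a given degree \<open>p\<close> simultaneously and so
  does not affect \<open>cell_matrix\<close>.\<close>

definition disc_generator :: "nat \<Rightarrow> (nat \<Rightarrow> real) chain set" where
  "disc_generator p =
     (SOME z. z \<in> carrier (relative_homology_group (int p) (disc p) (disc_boundary p)) \<and>
        generate (relative_homology_group (int p) (disc p) (disc_boundary p)) {z} =
          carrier (relative_homology_group (int p) (disc p) (disc_boundary p)))"

definition cell_generator :: "'a cw \<Rightarrow> nat \<Rightarrow> nat \<Rightarrow> 'a chain set" where
  "cell_generator X p i =
     hom_induced (int p) (disc p) (disc_boundary p)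
       (subtopology (cw_space X) (skeleton X (int p))) (skeleton X (int p - 1))
       (char_map X p i) (disc_generator p)"

text \<open>The matrix $C_p(g)$ of the endomorphism induced by a cellular map \<open>g\<close>, in the basis given by
  the \<open>p\<close>-cells: column \<open>j\<close> holds the coordinates of the image of the \<open>j\<close>-th cell.  The library
  writes homology groups multiplicatively.\<close>

definition cell_matrix :: "'a cw \<Rightarrow> nat \<Rightarrow> ('a \<Rightarrow> 'a) \<Rightarrow> int mat" where
  "cell_matrix X p g =
     (THE M. M \<in> carrier_mat (num_cells X p) (num_cells X p) \<and>
        (\<forall>j<num_cells X p. cell_chain_map X p g (cell_generator X p j) =
           finprod (cell_chain_group X p)
             (\<lambda>i. cell_generator X p i [^]\<^bsub>cell_chain_group X p\<^esub> (M $$ (i, j)))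
             {..<num_cells X p}))"


section \<open>The universal functorial Lefschetz invariant\<close>

text \<open>$\sum_p (-1)^p [C_p(g)]$, written multiplicatively in \<open>U_Z\<close>.  In the omitted degrees
  $C_p(g)$ is the $0 \times 0$ matrix, whose class is trivial.\<close>

definition cellular_lefschetz_class :: "'a cw \<Rightarrow> ('a \<Rightarrow> 'a) \<Rightarrow> (int mat \<Rightarrow>\<^sub>0 int) set" where
  "cellular_lefschetz_class X g =
     finprod U_Z (\<lambda>p. mat_class (cell_matrix X p g) [^]\<^bsub>U_Z\<^esub> ((-1) ^ p :: int))
       {p. num_cells X p \<noteq> 0}"

text \<open>The common value over all cellular maps homotopic to \<open>f\<close>.\<close>

definition universal_lefschetz :: "'a cw \<Rightarrow> ('a \<Rightarrow> 'a) \<Rightarrow> (int mat \<Rightarrow>\<^sub>0 int) set" where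
  "universal_lefschetz X f =
     (THE u. \<exists>g. cellular_map X g \<and>
        homotopic_with (\<lambda>h. True) (cw_space X) (cw_space X) f g \<and>
        u = cellular_lefschetz_class X g)"

end

theory Submission
  imports Defs "HOL-Analysis.Bounded_Continuous_Function"
begin

text \<open>Every element of \<open>U_Z\<close> has the form $[(1)] + [A] - [B]$, since block sums turn sums of generators
  into single generators.  So a complex with one 0-cell, with 2-cells on which the map acts by $A$
  and with 3-cells on which it acts by $B$ suffices.  A wedge of 2-spheres and 3-spheres works:
  excision shows that the characteristic map of a cell induces an isomorphism onto the homology of
  the pair it is attached to, and pinching a disc in the middle shows that the classes represented
  by maps of discs form a subgroup, hence contain every integral combination of the cells.  All
  attaching maps are constant and every skeleton is a retract, so the matrices of a cellular map
  depend only on its homotopy class.  Simple connectivity is the easy half of van Kampen's theorem.\<close>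

section \<open>Elements of $U(\mathbb{Z})$ as differences of two classes\<close>

text \<open>Dimensions 2 and 3 are the lowest pair of opposite parity above 1: parity supplies the
  two signs, and cells of dimension at least 2 create no essential loops. The 0-cell is unavoidable
  and always contributes the class of (1), because a cellular map fixes the only point of the
  0-skeleton; hence the special term in the normal form. \<open>universal_lefschetz\<close> is a
  definite description, so computing one value is not enough: every cellular map homotopic to the
  chosen one has to be compared with it. \<open>cell_matrix\<close> is a definite description too,
  which is why the independence of the cell generators matters. Quotient spaces are avoided. All
  cells are explicit teardrops in \<open>nat \<Rightarrow> real\<close> that share their tip, and
  compactness of the discs supplies the quotient topology whenever a map is defined cell by cell.
  Realizing a matrix rests on inverses and products of classes of disc maps alone. The only degree
  that enters is that of a reflection, and the Hurewicz theorem is bypassed.\<close>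

abbreviation FZ :: "(int mat \<Rightarrow>\<^sub>0 int) monoid" where
  "FZ \<equiv> free_Abelian_group square_int_mats"

lemma relators_subset: "block_relators \<union> conjugation_relators \<subseteq> carrier FZ"
proof -
  have f: "frag_of A \<in> carrier FZ" if "square_mat A" for A
    using that by (simp add: square_int_mats_def)
  have sub: "x - y \<in> carrier FZ" if "x \<in> carrier FZ" "y \<in> carrier FZ" for x y
    using that keys_diff[of x y] by auto
  have add: "x + y \<in> carrier FZ" if "x \<in> carrier FZ" "y \<in> carrier FZ" for x y
    using that Poly_Mapping.keys_add[of x y] by auto
  have "frag_of (four_block_mat B C (0\<^sub>m m n) D) - (frag_of B + frag_of D) \<in> carrier FZ"
    if "B \<in> carrier_mat n n" "C \<in> carrier_mat n m" "D \<in> carrier_mat m m" for B C D m n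
    using that by (intro sub add f) (auto simp: carrier_matD)
  moreover have "frag_of A' - frag_of A \<in> carrier FZ" if "similar_mat A' A" for A' A
    using that by (intro sub f) (auto dest!: similar_matD simp: carrier_matD)
  ultimately show ?thesis unfolding block_relators_def conjugation_relators_def by blast
qed

lemma subgroup_relation: "subgroup relation_subgroup FZ"
  unfolding relation_subgroup_def
  by (intro group.generate_is_subgroup relators_subset) simp

lemma relation_zero: "0 \<in> relation_subgroup"
  using subgroup.one_closed[OF subgroup_relation] by simp

lemma relation_add: "x \<in> relation_subgroup \<Longrightarrow> y \<in> relation_subgroup \<Longrightarrow> x + y \<in> relation_subgroup"
  using subgroup.m_closed[OF subgroup_relation] by simp

lemma relation_uminus: "x \<in> relation_subgroup \<Longrightarrow> - x \<in> relation_subgroup"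
  using subgroup.m_inv_closed[OF subgroup_relation, of x] subgroup.subset[OF subgroup_relation]
  by (auto simp: subset_iff)

lemma relation_diff: "x \<in> relation_subgroup \<Longrightarrow> y \<in> relation_subgroup \<Longrightarrow> x - y \<in> relation_subgroup"
  using relation_add[OF _ relation_uminus] by force

definition direct_sum :: "int mat \<Rightarrow> int mat \<Rightarrow> int mat" where
  "direct_sum A B = four_block_mat A (0\<^sub>m (dim_row A) (dim_row B)) (0\<^sub>m (dim_row B) (dim_row A)) B"

lemma direct_sum_carrier:
  "A \<in> carrier_mat n n \<Longrightarrow> B \<in> carrier_mat m m \<Longrightarrow> direct_sum A B \<in> carrier_mat (n + m) (n + m)"
  by (auto simp: direct_sum_def)

lemma direct_sum_relation:
  assumes "A \<in> carrier_mat n n" "B \<in> carrier_mat m m"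
  shows "frag_of (direct_sum A B) - (frag_of A + frag_of B) \<in> relation_subgroup"
proof -
  have "frag_of (direct_sum A B) - (frag_of A + frag_of B) \<in> block_relators"
    unfolding block_relators_def direct_sum_def using assms
    by (intro CollectI exI[of _ A] exI[of _ B] exI[of _ "0\<^sub>m n m"] exI[of _ m] exI[of _ n]) auto
  then show ?thesis unfolding relation_subgroup_def by (simp add: generate.incl)
qed

lemma normal_relation: "relation_subgroup \<lhd> FZ"
  by (simp add: subgroup_relation abelian_free_Abelian_group comm_group.normal_iff_subgroup)

lemma comm_group_U_Z: "comm_group U_Z"
  unfolding U_Z_def
  by (intro comm_group.abelian_FactGroup abelian_free_Abelian_group subgroup_relation)

lemma class_hom: "(\<lambda>c. relation_subgroup #>\<^bsub>FZ\<^esub> c) \<in> hom FZ U_Z"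
  unfolding U_Z_def by (rule normal.r_coset_hom_Mod[OF normal_relation])

lemma mat_class_carrier: "A \<in> carrier_mat n n \<Longrightarrow> mat_class A \<in> carrier U_Z"
  unfolding mat_class_def
  by (rule hom_in_carrier[OF class_hom]) (simp add: square_int_mats_def carrier_matD)

text \<open>Induction over differences of generators: \<open>(A - B) - (A' - B')\<close> becomes
  \<open>direct_sum A B'\<close> minus \<open>direct_sum B A'\<close> modulo block relators.
  Positive sizes are maintained so that the complex built later has cells in both dimensions; a
  generator may be 0 x 0, hence the added 1 x 1 block in the case of one generator.\<close>

lemma free_mod_relation:
  assumes "Poly_Mapping.keys c \<subseteq> square_int_mats"
  shows "\<exists>n m A B. n > 0 \<and> m > 0 \<and> A \<in> carrier_mat n n \<and> B \<in> carrier_mat m m \<and>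
    c - (frag_of A - frag_of B) \<in> relation_subgroup"
  using assms
proof (induction c rule: frag_induction)
  case zero
  show ?case
    by (rule exI[of _ 1], rule exI[of _ 1], rule exI[of _ "1\<^sub>m 1"], rule exI[of _ "1\<^sub>m 1"])
       (simp add: relation_zero)
next
  case (one x)
  then have x: "x \<in> carrier_mat (dim_row x) (dim_row x)" by (auto simp: square_int_mats_def)
  have i: "1\<^sub>m 1 \<in> carrier_mat 1 1" by simp
  have "- (frag_of (direct_sum x (1\<^sub>m 1)) - (frag_of x + frag_of (1\<^sub>m 1))) \<in> relation_subgroup"
    by (rule relation_uminus[OF direct_sum_relation[OF x i]])
  then have "frag_of x - (frag_of (direct_sum x (1\<^sub>m 1)) - frag_of (1\<^sub>m 1)) \<in> relation_subgroup"
    by (simp add: algebra_simps)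
  then show ?case using direct_sum_carrier[OF x i] i
    by (intro exI[of _ "dim_row x + 1"] exI[of _ 1] exI[of _ "direct_sum x (1\<^sub>m 1)"] exI[of _ "1\<^sub>m 1"] conjI)
       simp_all
next
  case (diff c d)
  then obtain n m A B n' m' A' B' where
    AB: "n > 0" "m > 0" "A \<in> carrier_mat n n" "B \<in> carrier_mat m m"
      "c - (frag_of A - frag_of B) \<in> relation_subgroup" and
    AB': "n' > 0" "m' > 0" "A' \<in> carrier_mat n' n'" "B' \<in> carrier_mat m' m'"
      "d - (frag_of A' - frag_of B') \<in> relation_subgroup" by blast
  have "(c - (frag_of A - frag_of B)) - (d - (frag_of A' - frag_of B'))
      - (frag_of (direct_sum A B') - (frag_of A + frag_of B'))
      + (frag_of (direct_sum B A') - (frag_of B + frag_of A')) \<in> relation_subgroup"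
    by (rule relation_add[OF relation_diff[OF relation_diff[OF AB(5) AB'(5)]
          direct_sum_relation[OF AB(3) AB'(4)]] direct_sum_relation[OF AB(4) AB'(3)]])
  then have "(c - d) - (frag_of (direct_sum A B') - frag_of (direct_sum B A')) \<in> relation_subgroup"
    by (simp add: algebra_simps)
  moreover have "n + m' > 0" "m + n' > 0" using AB by auto
  ultimately show ?case
    using direct_sum_carrier[OF AB(3) AB'(4)] direct_sum_carrier[OF AB(4) AB'(3)]
    by (intro exI[of _ "n + m'"] exI[of _ "m + n'"] exI[of _ "direct_sum A B'"] exI[of _ "direct_sum B A'"] conjI)
qed

lemma U_Z_represent:
  assumes "a \<in> carrier U_Z"
  obtains n m A B where "n > 0" "m > 0" "A \<in> carrier_mat n n" "B \<in> carrier_mat m m"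
    "a = mat_class (1\<^sub>m 1) \<otimes>\<^bsub>U_Z\<^esub> mat_class A \<otimes>\<^bsub>U_Z\<^esub> inv\<^bsub>U_Z\<^esub> mat_class B"
proof -
  interpret U: comm_group U_Z by (rule comm_group_U_Z)
  let ?q = "\<lambda>c. relation_subgroup #>\<^bsub>FZ\<^esub> c"
  interpret q: group_hom FZ U_Z ?q
    using class_hom by (simp add: group_hom_def group_hom_axioms_def U.is_group)
  obtain c where c: "c \<in> carrier FZ" "a = ?q c"
    using assms by (auto simp: U_Z_def FactGroup_def RCOSETS_def)
  obtain n m A B where AB: "n > 0" "m > 0" "A \<in> carrier_mat n n" "B \<in> carrier_mat m m"
    "c - (frag_of A - frag_of B) \<in> relation_subgroup"
    using free_mod_relation c(1) by (metis carrier_free_Abelian_group_iff)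
  \<comment> \<open>The extra block (1) in \<open>D\<close> cancels the class that the 0-cell is
    going to contribute.\<close>
  define D where "D = direct_sum B (1\<^sub>m 1)"
  have i: "1\<^sub>m 1 \<in> carrier_mat 1 (1::nat)" by simp
  have D: "D \<in> carrier_mat (m + 1) (m + 1)" unfolding D_def by (rule direct_sum_carrier[OF AB(4) i])
  have "c - (frag_of A - frag_of B) + (frag_of D - (frag_of B + frag_of (1\<^sub>m 1))) \<in> relation_subgroup"
    unfolding D_def by (rule relation_add[OF AB(5) direct_sum_relation[OF AB(4) i]])
  then have r: "c - (frag_of (1\<^sub>m 1) + frag_of A - frag_of D) \<in> relation_subgroup"
    by (simp add: algebra_simps)
  have fc: "frag_of M \<in> carrier FZ" if "M \<in> carrier_mat k k" for M k
    using that by (simp add: square_int_mats_def carrier_matD)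
  note car = fc[OF i] fc[OF AB(3)] fc[OF D]
  let ?e = "frag_of (1\<^sub>m 1) \<otimes>\<^bsub>FZ\<^esub> frag_of A \<otimes>\<^bsub>FZ\<^esub> inv\<^bsub>FZ\<^esub> frag_of D"
  have e: "?e \<in> carrier FZ" using car by (intro q.G.m_closed q.G.inv_closed)
  have "?e = frag_of (1\<^sub>m 1) + frag_of A - frag_of D"
    using car(3) by (simp only: mult_free_Abelian_group inv_free_Abelian_group carrier_free_Abelian_group_iff
        diff_conv_add_uminus)
  with r have "c \<otimes>\<^bsub>FZ\<^esub> inv\<^bsub>FZ\<^esub> ?e \<in> relation_subgroup"
    using e by (simp only: mult_free_Abelian_group inv_free_Abelian_group carrier_free_Abelian_group_iff diff_conv_add_uminus)
  then have "?q c = ?q ?e"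
    using subgroup.rcos_module_rev[OF subgroup_relation q.G.is_group e c(1)]
      q.G.repr_independence[OF _ e subgroup_relation, of c] by simp
  also have "\<dots> = ?q (frag_of (1\<^sub>m 1)) \<otimes>\<^bsub>U_Z\<^esub> ?q (frag_of A) \<otimes>\<^bsub>U_Z\<^esub> inv\<^bsub>U_Z\<^esub> ?q (frag_of D)"
    using car by (simp del: mult_free_Abelian_group inv_free_Abelian_group carrier_free_Abelian_group_iff frag_of_in_free_Abelian_group)
  finally show ?thesis
    using that[of n "m + 1" A D] AB D c(2) by (simp add: mat_class_def)
qed

section \<open>Homology of an attached cell\<close>

definition sumsq :: "nat \<Rightarrow> (nat \<Rightarrow> real) \<Rightarrow> real" where
  "sumsq p v = (\<Sum>i<p. (v i)\<^sup>2)"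

text \<open>A plain set in the product topology of \<open>nat \<Rightarrow> real\<close>, so that
  \<open>continuous_on\<close>, \<open>closed\<close> and \<open>compact\<close> apply;
  \<open>disc_eq\<close> leads back to \<open>disc\<close>.\<close>

definition Disc :: "nat \<Rightarrow> (nat \<Rightarrow> real) set" where
  "Disc p = {v. (\<forall>i\<ge>p. v i = 0) \<and> sumsq p v \<le> 1}"

definition Bdry :: "nat \<Rightarrow> (nat \<Rightarrow> real) set" where
  "Bdry p = {v. (\<forall>i\<ge>p. v i = 0) \<and> sumsq p v = 1}"

lemma Euclidean_space_eq: "Euclidean_space p = top_of_set {v. \<forall>i\<ge>p. v i = 0}"
  by (simp add: Euclidean_space_def euclidean_product_topology)

lemma disc_eq: "disc p = top_of_set (Disc p)"
  by (simp add: disc_def Disc_def Euclidean_space_eq subtopology_subtopology sumsq_def Collect_conj_eq)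

lemma disc_boundary_eq: "disc_boundary p = Bdry p"
  by (auto simp: disc_boundary_def Bdry_def topspace_Euclidean_space sumsq_def)

lemma disc_interior_eq: "disc_interior p = Disc p - Bdry p"
  by (auto simp: disc_interior_def Disc_def Bdry_def topspace_Euclidean_space sumsq_def)

lemma sumsq_nonneg [simp]: "0 \<le> sumsq p v"
  by (simp add: sumsq_def sum_nonneg)

lemma sumsq_scale: "sumsq p (\<lambda>i. c * v i) = c\<^sup>2 * sumsq p v"
  by (simp add: sumsq_def power_mult_distrib sum_distrib_left)

lemma sumsq_scale': "sumsq p (\<lambda>i. v i * c) = c\<^sup>2 * sumsq p v"
  using sumsq_scale[of p c v] by (simp add: mult.commute)

lemma continuous_on_app: "continuous_on S f \<Longrightarrow> continuous_on S (\<lambda>x. f x (i::nat) :: real)"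
  by (rule continuous_on_product_then_coordinatewise)

lemma continuous_on_sumsq [continuous_intros]:
  "continuous_on S f \<Longrightarrow> continuous_on S (\<lambda>x. sumsq p (f x))"
  unfolding sumsq_def
  by (intro continuous_on_sum continuous_on_power) (rule continuous_on_app)

lemma Bdry_subset_Disc: "Bdry p \<subseteq> Disc p"
  by (auto simp: Bdry_def Disc_def)

lemma closed_Collect_zero_from: "closed {v :: nat \<Rightarrow> real. \<forall>i\<ge>p. v i = 0}"
proof -
  have "{v :: nat \<Rightarrow> real. \<forall>i\<ge>p. v i = 0} = (\<Inter>i\<in>{p..}. {v. v i = 0})" by auto
  moreover have "closed {v :: nat \<Rightarrow> real. v i = 0}" for i
    by (intro closed_Collect_eq continuous_on_const) (rule continuous_on_app[OF continuous_on_id])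
  ultimately show ?thesis by auto
qed

lemma closed_Disc: "closed (Disc p)"
proof -
  have "closed {v. sumsq p v \<le> 1}"
    by (intro closed_Collect_le continuous_intros)
  with closed_Collect_zero_from[of p] show ?thesis
    unfolding Disc_def Collect_conj_eq by (rule closed_Int)
qed

lemma closed_Bdry: "closed (Bdry p)"
proof -
  have "closed {v. sumsq p v = 1}"
    by (intro closed_Collect_eq continuous_intros)
  with closed_Collect_zero_from[of p] show ?thesis
    unfolding Bdry_def Collect_conj_eq by (rule closed_Int)
qed

text \<open>Tychonoff: the disc is closed in a box whose factors are [-1, 1] below \<open>p\<close>
  and the single point 0 from \<open>p\<close> on.\<close>

lemma compact_Disc: "compact (Disc p)"
proof -
  let ?B = "\<lambda>i. if i < p then {-1..1} else {0::real}"
  have "compactin (powertop_real UNIV) (PiE UNIV ?B)"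
    by (auto simp: compactin_PiE)
  then have *: "compact (PiE UNIV ?B)"
    by (simp add: euclidean_product_topology)
  have "Disc p \<subseteq> PiE UNIV ?B"
  proof
    fix v assume v: "v \<in> Disc p"
    have "\<bar>v i\<bar> \<le> 1" if "i < p" for i
    proof -
      have "(v i)\<^sup>2 \<le> sumsq p v"
        unfolding sumsq_def using that by (intro member_le_sum) auto
      also have "\<dots> \<le> 1" using v by (simp add: Disc_def)
      finally show ?thesis by (simp add: abs_square_le_1)
    qed
    then show "v \<in> PiE UNIV ?B" using v by (force simp: Disc_def abs_le_iff)
  qed
  then have "Disc p = PiE UNIV ?B \<inter> Disc p" by auto
  with * closed_Disc show ?thesis by (metis compact_Int_closed)
qed

text \<open>A continuous map from a compact space to a Hausdorff space is closed, hence a quotient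
  map onto its image. This replaces quotient topologies: continuity on a closed cell is tested on
  the disc.\<close>

lemma continuous_on_compact_quotient:
  fixes q :: "'a::t2_space \<Rightarrow> 'b::t2_space" and f :: "'b \<Rightarrow> 'c::topological_space"
  assumes S: "compact S" and q: "continuous_on S q" and fq: "continuous_on S (\<lambda>x. f (q x))"
  shows "continuous_on (q ` S) f"
  unfolding continuous_on_closed_invariant
proof (intro allI impI)
  fix B :: "'c set" assume "closed B"
  then obtain K where K: "closed K" "K \<inter> S = (\<lambda>x. f (q x)) -` B \<inter> S"
    using fq unfolding continuous_on_closed_invariant by blast
  have "compact (S \<inter> K)" using S K(1) by (rule compact_Int_closed)
  moreover have "continuous_on (S \<inter> K) q" using q by (rule continuous_on_subset) auto
  ultimately have "closed (q ` (S \<inter> K))"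
    by (intro compact_imp_closed compact_continuous_image)
  moreover have "q ` (S \<inter> K) \<inter> q ` S = f -` B \<inter> q ` S"
  proof -
    have "x \<in> S \<inter> K \<longleftrightarrow> x \<in> S \<and> f (q x) \<in> B" for x using K(2) by auto
    then show ?thesis by auto
  qed
  ultimately show "\<exists>A. closed A \<and> A \<inter> q ` S = f -` B \<inter> q ` S" by blast
qed

text \<open>Homotopies of maps of pairs from \<open>(X, B)\<close> to \<open>(Y, T)\<close>, in the
  shape in which the homotopy axiom of relative homology consumes them.\<close>

lemma homotopic_with_top_of_setI:
  fixes h :: "real \<Rightarrow> 'a::topological_space \<Rightarrow> 'b::topological_space"
  assumes cont: "continuous_on ({0..1} \<times> X) (\<lambda>z. h (fst z) (snd z))"
    and im: "\<And>t x. 0 \<le> t \<Longrightarrow> t \<le> 1 \<Longrightarrow> x \<in> X \<Longrightarrow> h t x \<in> Y"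
    and h0: "\<And>x. x \<in> X \<Longrightarrow> h 0 x = f x" and h1: "\<And>x. x \<in> X \<Longrightarrow> h 1 x = g x"
    and B: "B \<subseteq> X" "\<And>t x. 0 \<le> t \<Longrightarrow> t \<le> 1 \<Longrightarrow> x \<in> B \<Longrightarrow> h t x \<in> T"
  shows "homotopic_with (\<lambda>k. k \<in> B \<rightarrow> T) (top_of_set X) (top_of_set Y) f g"
proof (subst homotopic_with)
  show "\<And>h k. (\<And>x. x \<in> topspace (top_of_set X) \<Longrightarrow> h x = k x)
      \<Longrightarrow> (h \<in> B \<rightarrow> T) = (k \<in> B \<rightarrow> T)"
    using B(1) by (auto simp: Pi_iff subset_iff)
  have "continuous_map (prod_topology (top_of_set {0..1}) (top_of_set X)) (top_of_set Y)
      (\<lambda>z. h (fst z) (snd z))"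
    using cont im by auto
  then show "\<exists>h. continuous_map (prod_topology (top_of_set {0..1::real}) (top_of_set X)) (top_of_set Y) h \<and>
      (\<forall>x\<in>topspace (top_of_set X). h (0, x) = f x) \<and>
      (\<forall>x\<in>topspace (top_of_set X). h (1, x) = g x) \<and>
      (\<forall>t\<in>{0..1}. (\<lambda>x. h (t, x)) \<in> B \<rightarrow> T)"
    using h0 h1 B by (intro exI[of _ "\<lambda>z. h (fst z) (snd z)"]) auto
qed

text \<open>Radial expansion by the factor \<open>1 + s\<close>, stopped at the unit sphere.  At \<open>s = 1\<close> it carries
  the annulus \<open>sumsq p v > 1/4\<close> onto the sphere.\<close>

definition clip :: "nat \<Rightarrow> real \<Rightarrow> (nat \<Rightarrow> real) \<Rightarrow> nat \<Rightarrow> real" where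
  "clip p s v = (\<lambda>i. v i * ((1 + s) / max 1 ((1 + s) * sqrt (sumsq p v))))"

lemma sumsq_clip:
  assumes "0 \<le> s"
  shows "sumsq p (clip p s v) = ((1 + s) * sqrt (sumsq p v) / max 1 ((1 + s) * sqrt (sumsq p v)))\<^sup>2"
  unfolding clip_def sumsq_scale' by (simp add: power_divide power_mult_distrib)

lemma clip_0: "v \<in> Disc p \<Longrightarrow> clip p 0 v = v"
proof -
  assume "v \<in> Disc p"
  then have "max 1 (sqrt (sumsq p v)) = 1" by (simp add: Disc_def)
  then show ?thesis by (simp add: clip_def)
qed

lemma clip_Bdry: "v \<in> Bdry p \<Longrightarrow> 0 \<le> s \<Longrightarrow> clip p s v = v"
  by (simp add: clip_def Bdry_def)

lemma clip_Disc: "v \<in> Disc p \<Longrightarrow> 0 \<le> s \<Longrightarrow> clip p s v \<in> Disc p"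
proof -
  assume v: "v \<in> Disc p" and s: "0 \<le> s"
  let ?a = "(1 + s) * sqrt (sumsq p v)"
  have "0 \<le> ?a / max 1 ?a" "?a / max 1 ?a \<le> 1" using s by simp_all
  then have "sumsq p (clip p s v) \<le> 1"
    unfolding sumsq_clip[OF s] by (rule power_le_one)
  then show ?thesis using v by (simp add: Disc_def clip_def)
qed

lemma clip_1:
  assumes "v \<in> Disc p" "sumsq p v > 1/4"
  shows "clip p 1 v \<in> Bdry p"
proof -
  have "sqrt (sumsq p v) > 1/2"
    using assms(2) by (intro real_less_rsqrt) (simp add: power2_eq_square)
  then have "max 1 (2 * sqrt (sumsq p v)) = 2 * sqrt (sumsq p v)" by simp
  moreover have "sumsq p v \<noteq> 0" using assms by auto
  ultimately have "sumsq p (clip p 1 v) = 1" by (simp add: sumsq_clip)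
  then show ?thesis using assms by (auto simp: Bdry_def Disc_def clip_def)
qed

text \<open>A clipped point either reaches the unit sphere or has its radius multiplied by
  \<open>1 + s\<close>, so the radius never falls. A homotopy of pairs must preserve the annulus at
  every time, not only at the end. The bound 1/4 is a squared radius: 1/2 is what the final doubling
  takes to the sphere.\<close>

lemma clip_annulus:
  assumes "v \<in> Disc p" "sumsq p v > 1/4" "0 \<le> s"
  shows "sumsq p (clip p s v) > 1/4"
proof -
  have h: "sqrt (sumsq p v) > 1/2"
    using assms(2) by (intro real_less_rsqrt) (simp add: power2_eq_square)
  have "(1 + s) * sqrt (sumsq p v) / max 1 ((1 + s) * sqrt (sumsq p v)) > 1/2"
  proof (cases "(1 + s) * sqrt (sumsq p v) \<ge> 1")
    case True
    then have "max 1 ((1 + s) * sqrt (sumsq p v)) = (1 + s) * sqrt (sumsq p v)"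
      by (simp add: max_absorb2)
    then show ?thesis using True by (simp only: divide_self_if) auto
  next
    case False
    have "1 * (1/2) < (1 + s) * sqrt (sumsq p v)"
      using h assms(3) by (intro mult_le_less_imp_less) auto
    then show ?thesis using False by (simp add: max_def)
  qed
  then have "(1/2)\<^sup>2 < ((1 + s) * sqrt (sumsq p v) / max 1 ((1 + s) * sqrt (sumsq p v)))\<^sup>2"
    by (intro power_strict_mono) auto
  then show ?thesis using assms(3) by (simp add: sumsq_clip power2_eq_square)
qed

lemma continuous_on_clip [continuous_intros]:
  assumes "continuous_on S s" "continuous_on S f"
  shows "continuous_on S (\<lambda>x. clip p (s x) (f x))"
  unfolding clip_def
proof (rule continuous_on_coordinatewise_then_product)
  fix i
  have f: "continuous_on S (\<lambda>x. f x i)" using assms(2) by (rule continuous_on_app)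
  show "continuous_on S (\<lambda>x. f x i * ((1 + s x) / max 1 ((1 + s x) * sqrt (sumsq p (f x)))))"
    by (intro continuous_intros f assms) (auto simp: max_def)
qed

section \<open>Attaching one cell: deformation, excision, comparison\<close>

lemma iso_of_comp_left:
  assumes "f \<in> iso A B" "h \<in> hom B C" "h \<circ> f \<in> iso A C" shows "h \<in> iso B C"
proof -
  have "bij_betw f (carrier A) (carrier B)" "bij_betw (h \<circ> f) (carrier A) (carrier C)"
    using assms by (simp_all add: iso_def)
  then have "bij_betw h (carrier B) (carrier C)" by (simp only: bij_betw_comp_iff)
  then show ?thesis using assms(2) by (simp add: iso_def)
qed

lemma iso_of_comp_right:
  assumes "g \<in> iso B C" "f \<in> hom A B" "g \<circ> f \<in> iso A C" shows "f \<in> iso A B"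
proof -
  have "f ` carrier A \<subseteq> carrier B" using assms(2) by (auto simp: hom_def)
  moreover have "bij_betw g (carrier B) (carrier C)" "bij_betw (g \<circ> f) (carrier A) (carrier C)"
    using assms by (simp_all add: iso_def)
  ultimately have "bij_betw f (carrier A) (carrier B)" by (simp only: bij_betw_comp_iff2)
  then show ?thesis using assms(2) by (simp add: iso_def)
qed

text \<open>An internal form of the pushout: \<open>X\<close> already lies in a Hausdorff space, and
  \<open>\<Phi>\<close> need be injective only on the open disc. Since \<open>A\<close> is closed
  and \<open>\<Phi>\<close> maps a compact disc, \<open>X\<close> carries the topology of the
  adjunction space.\<close>

locale cell_attachment =
  fixes X A :: "'a::t2_space set" and p :: nat and \<Phi> :: "(nat \<Rightarrow> real) \<Rightarrow> 'a"
  assumes cont: "continuous_on (Disc p) \<Phi>"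
    and X_eq: "X = A \<union> \<Phi> ` Disc p"
    and closed_A: "closed A"
    and bdry: "\<Phi> ` Bdry p \<subseteq> A"
    and inj: "inj_on \<Phi> (Disc p - Bdry p)"
    and disj: "\<Phi> ` (Disc p - Bdry p) \<inter> A = {}"
begin

definition push :: "real \<Rightarrow> 'a \<Rightarrow> 'a" where
  "push s x = (if x \<in> A then x else \<Phi> (clip p s (inv_into (Disc p - Bdry p) \<Phi> x)))"

definition collar :: "'a set" where
  "collar = A \<union> \<Phi> ` {v \<in> Disc p. sumsq p v > 1/4}"

lemma push_A: "x \<in> A \<Longrightarrow> push s x = x"
  by (simp add: push_def)

text \<open>The two branches of \<open>push\<close> agree on the boundary sphere, because
  \<open>clip\<close> fixes it and \<open>\<Phi>\<close> sends it into \<open>A\<close>.\<close>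

lemma push_cell: "v \<in> Disc p \<Longrightarrow> 0 \<le> s \<Longrightarrow> push s (\<Phi> v) = \<Phi> (clip p s v)"
proof (cases "v \<in> Bdry p")
  case True
  assume "0 \<le> s"
  then show ?thesis using True bdry by (auto simp: push_def clip_Bdry)
next
  case False
  assume "v \<in> Disc p"
  then have "v \<in> Disc p - Bdry p" using False by simp
  moreover from this have "\<Phi> v \<notin> A" using disj by blast
  ultimately show ?thesis using inj by (simp add: push_def inv_into_f_f)
qed

text \<open>Pasting over two closed pieces. On \<open>A\<close> the map is a projection; on the
  closed cell continuity is checked after pulling back to the compact set
  \<open>{0..1} \<times> Disc p\<close>.\<close>

lemma continuous_on_push: "continuous_on ({0..1} \<times> X) (\<lambda>z. push (fst z) (snd z))"
proof -
  let ?q = "\<lambda>z :: real \<times> (nat \<Rightarrow> real). (fst z, \<Phi> (snd z))"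
  have eq: "{0..1} \<times> X = ({0..1} \<times> A) \<union> ?q ` ({0..1} \<times> Disc p)"
    by (force simp: X_eq)
  have q: "continuous_on ({0..1} \<times> Disc p) ?q"
    by (intro continuous_intros continuous_on_compose2[OF cont]) auto
  have c: "compact ({0..1::real} \<times> Disc p)"
    by (intro compact_Times compact_Disc compact_Icc)
  show ?thesis unfolding eq
  proof (rule continuous_on_closed_Un)
    show "closed ({0..1::real} \<times> A)" by (intro closed_Times closed_A closed_atLeastAtMost)
    show "closed (?q ` ({0..1} \<times> Disc p))"
      by (intro compact_imp_closed compact_continuous_image q c)
    have "continuous_on ({0..1} \<times> A) (\<lambda>z :: real \<times> 'a. snd z)" by (intro continuous_intros)
    then show "continuous_on ({0..1} \<times> A) (\<lambda>z. push (fst z) (snd z))"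
      by (rule continuous_on_eq) (auto simp: push_A)
    show "continuous_on (?q ` ({0..1} \<times> Disc p)) (\<lambda>z. push (fst z) (snd z))"
    proof (rule continuous_on_compact_quotient[OF c q])
      have "continuous_on ({0..1} \<times> Disc p) (\<lambda>z. \<Phi> (clip p (fst z) (snd z)))"
        by (intro continuous_on_compose2[OF cont] continuous_intros) (auto simp: clip_Disc)
      then show "continuous_on ({0..1} \<times> Disc p) (\<lambda>z. push (fst (?q z)) (snd (?q z)))"
        by (rule continuous_on_eq) (auto simp: push_cell)
    qed
  qed
qed

lemma push_0: "x \<in> X \<Longrightarrow> push 0 x = x"
  by (auto simp: X_eq push_A push_cell clip_0)

lemma push_X: "x \<in> X \<Longrightarrow> 0 \<le> s \<Longrightarrow> push s x \<in> X"
  by (auto simp: X_eq push_A push_cell clip_Disc)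

lemma push_collar: "x \<in> collar \<Longrightarrow> 0 \<le> s \<Longrightarrow> push s x \<in> collar"
  unfolding collar_def using clip_annulus[of _ p s] clip_Disc[of _ p s]
  by (auto simp: push_A push_cell)

lemma push_1_collar: "x \<in> collar \<Longrightarrow> push 1 x \<in> A"
  using bdry by (auto simp: collar_def push_A push_cell clip_1 image_subset_iff)

lemma A_subset: "A \<subseteq> X" "A \<subseteq> collar" "collar \<subseteq> X"
  by (auto simp: X_eq collar_def)

lemma homotopic_push:
  assumes "B \<subseteq> X" "\<And>s x. 0 \<le> s \<Longrightarrow> x \<in> B \<Longrightarrow> push s x \<in> B"
  shows "homotopic_with (\<lambda>h. h \<in> B \<rightarrow> B) (top_of_set X) (top_of_set X) id (push 1)"
  by (rule homotopic_with_top_of_setI[OF continuous_on_push])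
     (use assms in \<open>auto simp: push_0 push_X\<close>)

lemma continuous_on_push_1: "continuous_on X (push 1)"
proof -
  have "continuous_on X (\<lambda>x. push (fst (1::real, x)) (snd (1::real, x)))"
    by (rule continuous_on_compose2[OF continuous_on_push]) (auto intro!: continuous_intros)
  then show ?thesis by simp
qed

text \<open>\<open>push 1\<close> is a homotopy inverse of the inclusion of pairs:
  \<open>push\<close> deforms the identity to it and keeps both \<open>A\<close> and
  \<open>collar\<close> inside themselves.\<close>

lemma iso_collar:
  "hom_induced q (top_of_set X) A (top_of_set X) collar id
    \<in> iso (relative_homology_group q (top_of_set X) A) (relative_homology_group q (top_of_set X) collar)"
proof (rule homotopy_equivalence_relative_homology_group_isomorphism)
  show "continuous_map (top_of_set X) (top_of_set X) (push 1)"
    using continuous_on_push_1 push_X[of _ 1] by (simp add: Pi_iff)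
  show "push 1 \<in> collar \<rightarrow> A" by (simp add: push_1_collar)
  have "homotopic_with (\<lambda>h. h \<in> A \<rightarrow> A) (top_of_set X) (top_of_set X) id (push 1)"
    by (rule homotopic_push) (use A_subset in \<open>auto simp: push_A\<close>)
  then show "homotopic_with (\<lambda>h. h \<in> A \<rightarrow> A) (top_of_set X) (top_of_set X) (push 1 \<circ> id) id"
    by (simp add: homotopic_with_sym)
  have "homotopic_with (\<lambda>h. h \<in> collar \<rightarrow> collar) (top_of_set X) (top_of_set X) id (push 1)"
    by (rule homotopic_push) (use A_subset in \<open>auto simp: push_collar\<close>)
  then show "homotopic_with (\<lambda>h. h \<in> collar \<rightarrow> collar) (top_of_set X) (top_of_set X) (id \<circ> push 1) id"
    by (simp add: homotopic_with_sym)
qed (use A_subset in auto)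

text \<open>The complement is the image of the closed disc of radius 1/2, hence compact. Injectivity
  on the open disc keeps the annulus from meeting that image. Openness is what excision of the
  closed set \<open>A\<close> asks of \<open>collar\<close>.\<close>

lemma openin_collar: "openin (top_of_set X) collar"
proof -
  let ?K = "{v \<in> Disc p. sumsq p v \<le> 1/4}"
  have "Bdry p \<inter> ?K = {}" by (auto simp: Bdry_def)
  then have K: "?K \<subseteq> Disc p - Bdry p" by auto
  have "?K = Disc p \<inter> {v. sumsq p v \<le> 1/4}" by auto
  moreover have "closed {v. sumsq p v \<le> 1/4}" by (intro closed_Collect_le continuous_intros)
  ultimately have "compact ?K" by (metis compact_Disc compact_Int_closed)
  then have "closed (\<Phi> ` ?K)"
    by (intro compact_imp_closed compact_continuous_image continuous_on_subset[OF cont]) auto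
  moreover have "collar = X - \<Phi> ` ?K"
  proof -
    have 1: "\<Phi> v \<notin> \<Phi> ` ?K" if v: "v \<in> Disc p" "sumsq p v > 1/4" for v
    proof
      assume "\<Phi> v \<in> \<Phi> ` ?K"
      then obtain w where w: "w \<in> ?K" "\<Phi> v = \<Phi> w" by auto
      have "v \<notin> Bdry p" using w K disj bdry by blast
      then have "v = w" using w K v inj by (auto dest: inj_onD)
      then show False using w v by simp
    qed
    have "A \<inter> \<Phi> ` ?K = {}" using K disj by blast
    with 1 have "collar \<inter> \<Phi> ` ?K = {}" unfolding collar_def by blast
    moreover have "Disc p = {v \<in> Disc p. sumsq p v > 1/4} \<union> ?K" by auto
    then have "X = collar \<union> \<Phi> ` ?K" unfolding collar_def X_eq by (metis Un_assoc image_Un)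
    ultimately show ?thesis by blast
  qed
  ultimately show ?thesis
    by (metis Diff_eq openin_open_Int open_Compl)
qed

lemma iso_excision:
  "hom_induced q (top_of_set (X - A)) (collar - A) (top_of_set X) collar id
    \<in> iso (relative_homology_group q (top_of_set (X - A)) (collar - A))
          (relative_homology_group q (top_of_set X) collar)"
proof -
  have "closedin (top_of_set X) A" using closed_A A_subset by (simp add: closed_subset)
  then have "top_of_set X closure_of A = A" by (simp add: closure_of_closedin)
  moreover have "top_of_set X interior_of collar = collar"
    using openin_collar by (simp add: interior_of_openin)
  ultimately have "hom_induced q (subtopology (top_of_set X) (X - A)) (collar - A) (subtopology (top_of_set X) X) collar id
    \<in> iso (relative_homology_group q (subtopology (top_of_set X) (X - A)) (collar - A))
          (relative_homology_group q (subtopology (top_of_set X) X) collar)"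
    using A_subset by (intro homology_excision_axiom) auto
  moreover have "X \<inter> (X - A) = X - A" by auto
  ultimately show ?thesis by (simp add: subtopology_subtopology)
qed

text \<open>For closedness of the map, extend a closed subset of the open disc to a closed subset of
  \<open>Disc p\<close>. Its image is compact, and the added boundary points land in
  \<open>A\<close>, outside the target.\<close>

lemma homeomorphic_cell:
  "homeomorphic_map (top_of_set (Disc p - Bdry p)) (top_of_set (X - A)) \<Phi>"
proof (rule bijective_closed_imp_homeomorphic_map)
  have im: "\<Phi> ` (Disc p - Bdry p) = X - A" using bdry disj by (auto simp: X_eq)
  then show "\<Phi> ` topspace (top_of_set (Disc p - Bdry p)) = topspace (top_of_set (X - A))" by simp
  show "inj_on \<Phi> (topspace (top_of_set (Disc p - Bdry p)))" using inj by simp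
  show "continuous_map (top_of_set (Disc p - Bdry p)) (top_of_set (X - A)) \<Phi>"
    using continuous_on_subset[OF cont] im by auto
  show "closed_map (top_of_set (Disc p - Bdry p)) (top_of_set (X - A)) \<Phi>"
    unfolding closed_map_def
  proof (intro allI impI)
    fix B assume "closedin (top_of_set (Disc p - Bdry p)) B"
    then obtain K where K: "closed K" "B = (Disc p - Bdry p) \<inter> K" by (auto simp: closedin_closed)
    have "closed (\<Phi> ` (Disc p \<inter> K))"
      by (intro compact_imp_closed compact_continuous_image continuous_on_subset[OF cont]
            compact_Int_closed compact_Disc K) auto
    moreover have "\<Phi> ` B = (X - A) \<inter> \<Phi> ` (Disc p \<inter> K)"
      using bdry disj by (auto simp: K X_eq image_iff)
    ultimately show "closedin (top_of_set (X - A)) (\<Phi> ` B)" by (auto simp: closedin_closed)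
  qed
qed

end

text \<open>The model case: the disc is its own boundary with a cell attached by the identity, so
  deformation and excision hold for it as well and can be compared with those of any other
  attachment.\<close>

lemma cell_attachment_Disc: "cell_attachment (Disc p) (Bdry p) p id"
  by unfold_locales (use Bdry_subset_Disc closed_Bdry in auto)

context cell_attachment begin

text \<open>Enlarge \<open>A\<close> to \<open>collar\<close> by a deformation, excise \<open>A\<close>, and compare with the same two steps for the
  pair of the disc and its boundary, where \<open>\<Phi>\<close> restricts to a homeomorphism.\<close>

lemma iso_cell:
  "hom_induced q (top_of_set (Disc p)) (Bdry p) (top_of_set X) A \<Phi>
    \<in> iso (relative_homology_group q (top_of_set (Disc p)) (Bdry p)) (relative_homology_group q (top_of_set X) A)"
proof -
  interpret D: cell_attachment "Disc p" "Bdry p" p id by (rule cell_attachment_Disc)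
  note hc = hom_induced_compose[symmetric]
  have im: "\<Phi> ` (Disc p - Bdry p) = X - A" using bdry disj by (auto simp: X_eq)
  have cont': "continuous_map (top_of_set (Disc p)) (top_of_set X) \<Phi>" using cont X_eq by auto
  have cont'': "continuous_map (top_of_set (Disc p - Bdry p)) (top_of_set (X - A)) \<Phi>"
    using homeomorphic_cell homeomorphic_imp_continuous_map by blast
  have col: "\<Phi> \<in> D.collar \<rightarrow> collar" using bdry by (auto simp: collar_def D.collar_def)
  have col_im: "\<Phi> ` (D.collar - Bdry p) = collar - A"
    using bdry disj by (auto simp: collar_def D.collar_def)
  have col': "\<Phi> \<in> D.collar - Bdry p \<rightarrow> collar - A" using col_im by auto
  let ?H = "relative_homology_group q"
  let ?f = "hom_induced q (top_of_set (Disc p - Bdry p)) (D.collar - Bdry p) (top_of_set (X - A)) (collar - A) \<Phi>"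
  let ?e = "hom_induced q (top_of_set (X - A)) (collar - A) (top_of_set X) collar id"
  let ?e' = "hom_induced q (top_of_set (Disc p - Bdry p)) (D.collar - Bdry p) (top_of_set (Disc p)) D.collar id"
  let ?g = "hom_induced q (top_of_set (Disc p)) D.collar (top_of_set X) collar \<Phi>"
  have "?f \<in> iso (?H (top_of_set (Disc p - Bdry p)) (D.collar - Bdry p)) (?H (top_of_set (X - A)) (collar - A))"
    by (rule homeomorphic_map_relative_homology_iso[OF homeomorphic_cell _ col_im])
       (use D.A_subset in auto)
  then have "?e \<circ> ?f \<in> iso (?H (top_of_set (Disc p - Bdry p)) (D.collar - Bdry p)) (?H (top_of_set X) collar)"
    using iso_excision by (rule iso_set_trans)
  moreover have "?e \<circ> ?f = ?g \<circ> ?e'"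
    using cont' cont'' col col' by (simp add: hc Pi_iff)
  ultimately have "?g \<circ> ?e' \<in> iso (?H (top_of_set (Disc p - Bdry p)) (D.collar - Bdry p)) (?H (top_of_set X) collar)"
    by simp
  then have "?g \<in> iso (?H (top_of_set (Disc p)) D.collar) (?H (top_of_set X) collar)"
    by (rule iso_of_comp_left[OF D.iso_excision hom_induced_hom])
  then have "?g \<circ> hom_induced q (top_of_set (Disc p)) (Bdry p) (top_of_set (Disc p)) D.collar id
      \<in> iso (?H (top_of_set (Disc p)) (Bdry p)) (?H (top_of_set X) collar)"
    by (rule iso_set_trans[OF D.iso_collar])
  moreover have "?g \<circ> hom_induced q (top_of_set (Disc p)) (Bdry p) (top_of_set (Disc p)) D.collar id
    = hom_induced q (top_of_set X) A (top_of_set X) collar id \<circ> hom_induced q (top_of_set (Disc p)) (Bdry p) (top_of_set X) A \<Phi>"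
    using cont' col bdry D.A_subset A_subset by (simp add: hc Pi_iff image_subset_iff subset_iff)
  ultimately show ?thesis
    by (metis iso_of_comp_right[OF iso_collar hom_induced_hom])
qed

end

section \<open>The homology of a disc relative to its boundary\<close>

lemma group_homI: "group G \<Longrightarrow> group H \<Longrightarrow> h \<in> hom G H \<Longrightarrow> group_hom G H h"
  by (simp add: group_hom_def group_hom_axioms_def)

text \<open>The induced map factors through the homology of \<open>B\<close> relative to itself,
  which vanishes.\<close>

lemma hom_induced_into_subspace:
  assumes f: "continuous_map X Y f" "f ` topspace X \<subseteq> B"
  shows "hom_induced q X S Y B f c = \<one>\<^bsub>relative_homology_group q Y B\<^esub>"
proof -
  have f': "continuous_map X (subtopology Y B) f" using f by (auto simp: continuous_map_in_subtopology)
  have B: "f \<in> topspace X \<inter> S \<rightarrow> B" using f by auto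
  let ?g = "hom_induced q X (topspace X \<inter> S) (subtopology Y B) B f"
  have triv: "trivial_group (relative_homology_group q (subtopology Y B) B)"
    using trivial_relative_homology_group_topspace[of q "subtopology Y B"]
      relative_homology_group_restrict[of q "subtopology Y B" B]
    by (simp add: Int_absorb2 Int_absorb1 inf.assoc)
  have "?g c \<in> carrier (relative_homology_group q (subtopology Y B) B)"
    by (rule hom_induced_carrier)
  then have 1: "?g c = \<one>\<^bsub>relative_homology_group q (subtopology Y B) B\<^esub>"
    using triv by (simp add: trivial_group_def)
  \<comment> \<open>\<open>S\<close> may stick out of the space, so it is first cut down to its
    trace, on which \<open>f\<close> is known to land in \<open>B\<close>.\<close>
  have "hom_induced q X S Y B f c = hom_induced q X (topspace X \<inter> S) Y B (id \<circ> f) c"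
    by (metis hom_induced_restrict inf_left_idem id_comp)
  also have "\<dots> = hom_induced q (subtopology Y B) B Y B id (?g c)"
    using f' B by (subst hom_induced_compose') (auto simp: continuous_map_from_subtopology)
  also have "\<dots> = \<one>\<^bsub>relative_homology_group q Y B\<^esub>"
    unfolding 1 by (rule hom_one[OF hom_induced_hom]) auto
  finally show ?thesis .
qed

lemma contractible_space_disc: "contractible_space (disc p)"
  unfolding contractible_space_def disc_eq
proof (intro exI)
  let ?h = "\<lambda>(t::real) (v::nat \<Rightarrow> real) i. (1 - t) * v i"
  have "homotopic_with (\<lambda>k. k \<in> {} \<rightarrow> {}) (top_of_set (Disc p)) (top_of_set (Disc p)) id (\<lambda>x i. 0)"
  proof (rule homotopic_with_top_of_setI[of _ ?h])
    show "continuous_on ({0..1} \<times> Disc p) (\<lambda>z. ?h (fst z) (snd z))"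
      by (intro continuous_on_coordinatewise_then_product continuous_on_mult continuous_on_diff
          continuous_on_const continuous_on_fst continuous_on_id)
         (rule continuous_on_app, intro continuous_intros)
    show "?h t v \<in> Disc p" if "0 \<le> t" "t \<le> 1" "v \<in> Disc p" for t v
    proof -
      have "(1 - t)\<^sup>2 * sumsq p v \<le> 1 * 1"
        using that by (intro mult_mono power_le_one) (auto simp: Disc_def)
      then show ?thesis using that by (auto simp: Disc_def sumsq_scale)
    qed
  qed auto
  then show "homotopic_with (\<lambda>x. True) (top_of_set (Disc p)) (top_of_set (Disc p)) id (\<lambda>x i. 0)"
    by (rule homotopic_with_mono) auto
qed

lemma subtopology_disc_boundary: "subtopology (disc (Suc n)) (disc_boundary (Suc n)) = nsphere n"
proof -
  have "Disc (Suc n) \<inter> Bdry (Suc n) = Bdry (Suc n)" using Bdry_subset_Disc by blast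
  then show ?thesis
    by (simp add: disc_eq disc_boundary_eq subtopology_subtopology nsphere_def Euclidean_space_eq
        Bdry_def sumsq_def lessThan_Suc_atMost Collect_conj_eq)
qed

abbreviation disc_group :: "nat \<Rightarrow> (nat \<Rightarrow> real) chain set monoid" where
  "disc_group p \<equiv> relative_homology_group (int p) (disc p) (disc_boundary p)"

text \<open>In the long exact sequence of the pair the reduced homology of the contractible disc
  vanishes. The point exhibited in the proof shows that the sphere is nonempty.\<close>

lemma hom_boundary_disc_iso:
  "hom_boundary (int (Suc n)) (disc (Suc n)) (disc_boundary (Suc n))
    \<in> iso (disc_group (Suc n)) (reduced_homology_group (int n) (nsphere n))"
proof -
  have "(\<lambda>i. if i = 0 then 1 else 0) \<in> topspace (disc (Suc n)) \<inter> disc_boundary (Suc n)"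
    by (auto simp: disc_eq disc_boundary_eq Disc_def Bdry_def sumsq_def if_distrib[of "\<lambda>x. x\<^sup>2"] cong: if_cong)
  then show ?thesis
    using iso_relative_homology_of_contractible[OF contractible_space_disc,
        of "Suc n" "disc_boundary (Suc n)" "int (Suc n)"]
    by (auto simp: subtopology_disc_boundary)
qed

lemma disc_group_iso: "disc_group p \<cong> integer_group"
proof (cases p)
  case 0
  have "topspace (disc 0) = {\<lambda>i. 0}" by (auto simp: disc_eq Disc_def sumsq_def)
  moreover have "disc_boundary 0 = {}" by (auto simp: disc_boundary_eq Bdry_def sumsq_def)
  ultimately show ?thesis using 0 homology_coefficients by fastforce
next
  case (Suc n)
  then show ?thesis
    using hom_boundary_disc_iso[of n] reduced_homology_group_nsphere(1)[of n]
    by (metis is_isoI iso_trans)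
qed

lemma disc_generator:
  shows disc_generator_carrier: "disc_generator p \<in> carrier (disc_group p)"
    and disc_generator_generate: "generate (disc_group p) {disc_generator p} = carrier (disc_group p)"
proof -
  interpret G: group "disc_group p" by simp
  obtain h where h: "h \<in> iso integer_group (disc_group p)"
    using disc_group_iso[of p] G.iso_sym group.iso_sym[OF group_relative_homology_group] is_iso_def by blast
  then have hom: "h \<in> hom integer_group (disc_group p)"
    and bij: "bij_betw h UNIV (carrier (disc_group p))" by (auto simp: iso_def)
  interpret h: group_hom integer_group "disc_group p" h
    by (rule group_homI) (use hom in auto)
  have c: "h 1 \<in> carrier (disc_group p)" using bij by (auto simp: bij_betw_def)
  have "generate (disc_group p) {h 1} = carrier (disc_group p)"
  proof -
    have hk: "h k = h 1 [^]\<^bsub>disc_group p\<^esub> k" for k :: int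
      using h.hom_int_pow[of 1 k] by simp
    have "carrier (disc_group p) = range h" using bij by (simp add: bij_betw_def)
    also have "\<dots> = range (\<lambda>k :: int. h 1 [^]\<^bsub>disc_group p\<^esub> k)"
      using hk by (rule image_cong[OF refl])
    finally have "carrier (disc_group p) = range (\<lambda>k :: int. h 1 [^]\<^bsub>disc_group p\<^esub> k)" .
    then show ?thesis unfolding G.generate_pow[OF c] by (simp only: full_SetCompr_eq UNIV_I simp_thms)
  qed
  with c have "\<exists>z. z \<in> carrier (disc_group p) \<and> generate (disc_group p) {z} = carrier (disc_group p)"
    by blast
  then have "disc_generator p \<in> carrier (disc_group p) \<and>
      generate (disc_group p) {disc_generator p} = carrier (disc_group p)"
    unfolding disc_generator_def by (rule someI_ex)
  then show "disc_generator p \<in> carrier (disc_group p)"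
    and "generate (disc_group p) {disc_generator p} = carrier (disc_group p)" by auto
qed

text \<open>An element that generates an infinite cyclic group has infinite order: some power of it
  corresponds to the integer 1, so its own integer is nonzero. This is the source of uniqueness for
  matrix entries.\<close>

lemma disc_generator_pow_inject:
  fixes k l :: int
  assumes "disc_generator p [^]\<^bsub>disc_group p\<^esub> k = disc_generator p [^]\<^bsub>disc_group p\<^esub> l"
  shows "k = l"
proof -
  interpret G: group "disc_group p" by simp
  obtain h where h: "h \<in> iso (disc_group p) integer_group"
    using disc_group_iso[of p] is_iso_def by blast
  then have bij: "bij_betw h (carrier (disc_group p)) UNIV" by (auto simp: iso_def)
  interpret h: group_hom "disc_group p" integer_group h
    by (rule group_homI) (use h in \<open>auto simp: iso_def\<close>)
  note z = disc_generator_carrier[of p]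
  have hz: "h (disc_generator p [^]\<^bsub>disc_group p\<^esub> m) = m * h (disc_generator p)" for m :: int
    using h.hom_int_pow[OF z, of m] by simp
  obtain x where x: "x \<in> carrier (disc_group p)" "h x = 1"
    using bij by (metis UNIV_I bij_betw_def imageE)
  then have "x \<in> {disc_generator p [^]\<^bsub>disc_group p\<^esub> k |k. k \<in> (UNIV :: int set)}"
    using disc_generator_generate[of p] G.generate_pow[OF z] by simp
  then have "h (disc_generator p) \<noteq> 0" using hz x by auto
  moreover have "k * h (disc_generator p) = l * h (disc_generator p)" using assms hz by metis
  ultimately show ?thesis by simp
qed

section \<open>A reflection inverts the classes of the disc\<close>

definition flip :: "(nat \<Rightarrow> real) \<Rightarrow> nat \<Rightarrow> real" where
  "flip v = (\<lambda>i. if i = 0 then - v i else v i)"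

lemma sumsq_flip [simp]: "sumsq p (flip v) = sumsq p v"
  by (auto simp: sumsq_def flip_def intro!: sum.cong)

lemma continuous_on_flip: "continuous_on S f \<Longrightarrow> continuous_on S (\<lambda>x. flip (f x))"
proof -
  assume f: "continuous_on S f"
  have "continuous_on S (\<lambda>x. if i = 0 then - f x i else f x i)" for i
    using continuous_on_app[OF f, of i] by (cases "i = 0") (auto intro: continuous_on_minus)
  then show ?thesis unfolding flip_def by (rule continuous_on_coordinatewise_then_product)
qed

lemma flip_Disc: "1 \<le> p \<Longrightarrow> flip v \<in> Disc p \<longleftrightarrow> v \<in> Disc p"
  by (auto simp: Disc_def) (auto simp: flip_def)

lemma flip_Bdry: "1 \<le> p \<Longrightarrow> flip v \<in> Bdry p \<longleftrightarrow> v \<in> Bdry p"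
  by (auto simp: Bdry_def) (auto simp: flip_def)

text \<open>The connecting homomorphism is natural and injective, so the sign can be read off on the
  boundary sphere, where the reflection has Brouwer degree -1.\<close>

lemma hom_induced_flip:
  assumes p: "1 \<le> p" and z: "z \<in> carrier (disc_group p)"
  shows "hom_induced (int p) (disc p) (disc_boundary p) (disc p) (disc_boundary p) flip z = inv\<^bsub>disc_group p\<^esub> z"
proof -
  obtain n where n: "p = Suc n" using p by (cases p) auto
  let ?R = "reduced_homology_group (int n) (nsphere n)"
  let ?b = "hom_boundary (int p) (disc p) (disc_boundary p)"
  let ?f = "hom_induced (int p) (disc p) (disc_boundary p) (disc p) (disc_boundary p) flip"
  have cont: "continuous_map (disc p) (disc p) flip"
    unfolding disc_eq using continuous_on_flip[OF continuous_on_id] flip_Disc[OF p] by auto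
  have im: "flip \<in> disc_boundary p \<rightarrow> disc_boundary p"
    using flip_Bdry[OF p] by (simp add: disc_boundary_eq)
  have b: "?b \<in> iso (disc_group p) ?R" using hom_boundary_disc_iso n by simp
  then have inj: "inj_on ?b (carrier (disc_group p))" and bh: "?b \<in> hom (disc_group p) ?R"
    by (auto simp: iso_def bij_betw_def)
  interpret b: group_hom "disc_group p" ?R ?b by (rule group_homI) (use bh in auto)
  have bz: "?b z \<in> carrier ?R" using z by simp
  have eq: "hom_induced (int n) (nsphere n) {} (nsphere n) {} flip
      = hom_induced (int n) (nsphere n) {} (nsphere n) {} (\<lambda>x i. if i = 0 then -x i else x i)"
    by (rule hom_induced_eq) (simp add: fun_eq_iff flip_def)
  have "?b (?f z) = hom_induced (int n) (nsphere n) {} (nsphere n) {} flip (?b z)"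
    using fun_cong[OF naturality_hom_induced[OF cont im, of "int p"], of z]
    by (simp add: n subtopology_disc_boundary)
  also have "\<dots> = ?b z [^]\<^bsub>?R\<^esub> (-1 :: int)"
    unfolding eq using Brouwer_degree2[OF bz] Brouwer_degree2_reflection by simp
  also have "\<dots> = inv\<^bsub>?R\<^esub> ?b z" using b.H.int_pow_neg[OF bz, of 1] b.H.int_pow_1[OF bz] by simp
  also have "\<dots> = ?b (inv\<^bsub>disc_group p\<^esub> z)" using z by simp
  finally show ?thesis
    using inj z by (meson b.G.inv_closed hom_induced_carrier inj_onD)
qed

section \<open>Wedges of spheres in a space of sequences\<close>

text \<open>The coordinates are numbered by pairs of a cell \<open>(p, i)\<close> and a slot \<open>j\<close>; a point of a wedge
  has nonzero coordinates for at most one cell.\<close>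

type_synonym cell = "nat \<times> nat"

definition blk :: "cell \<Rightarrow> nat \<Rightarrow> nat" where
  "blk c j = prod_encode (prod_encode c, j)"

definition cell_of :: "nat \<Rightarrow> cell" where
  "cell_of m = prod_decode (fst (prod_decode m))"

definition slot_of :: "nat \<Rightarrow> nat" where
  "slot_of m = snd (prod_decode m)"

lemma cell_of_blk [simp]: "cell_of (blk c j) = c" and slot_of_blk [simp]: "slot_of (blk c j) = j"
  by (simp_all add: cell_of_def slot_of_def blk_def)

lemma blk_cell_slot [simp]: "blk (cell_of m) (slot_of m) = m"
  by (simp add: cell_of_def slot_of_def blk_def)

text \<open>The image of the disc is a teardrop with tip at the origin: slots below \<open>p\<close> hold
  $(1 - |v|^2) v$, slot \<open>p\<close> holds the height $1 - |v|^2$.  The truncation at 0 extends the map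
  continuously to all \<open>v\<close>, with value the origin outside the disc.\<close>

definition cell_map :: "cell \<Rightarrow> (nat \<Rightarrow> real) \<Rightarrow> nat \<Rightarrow> real" where
  "cell_map c v = (\<lambda>m. if cell_of m = c then
      max 0 (1 - sumsq (fst c) v) *
        (if slot_of m < fst c then v (slot_of m) else if slot_of m = fst c then 1 else 0)
     else 0)"

abbreviation origin :: "nat \<Rightarrow> real" where
  "origin \<equiv> \<lambda>m. 0"

lemma continuous_on_cell_map:
  assumes f: "continuous_on S f"
  shows "continuous_on S (\<lambda>x. cell_map c (f x))"
proof -
  have "continuous_on S (\<lambda>x. cell_map c (f x) m)" for m
  proof -
    have *: "continuous_on S (\<lambda>x. f x (slot_of m))" using f by (rule continuous_on_app)
    show ?thesis
      by (cases "cell_of m = c"; cases "slot_of m < fst c"; cases "slot_of m = fst c")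
         (auto simp: cell_map_def intro!: continuous_intros f *)
  qed
  then show ?thesis by (rule continuous_on_coordinatewise_then_product)
qed

lemma cell_map_height: "cell_map c v (blk c (fst c)) = max 0 (1 - sumsq (fst c) v)"
  by (simp add: cell_map_def)

lemma cell_map_other: "cell_of m \<noteq> c \<Longrightarrow> cell_map c v m = 0"
  by (simp add: cell_map_def)

lemma cell_map_eq_origin: "cell_map c v = origin \<longleftrightarrow> 1 \<le> sumsq (fst c) v"
proof
  assume "cell_map c v = origin"
  then have "cell_map c v (blk c (fst c)) = 0" by simp
  then show "1 \<le> sumsq (fst c) v" by (simp add: cell_map_height max_def split: if_splits)
qed (simp add: cell_map_def fun_eq_iff)

lemma cell_map_Bdry: "v \<in> Bdry (fst c) \<Longrightarrow> cell_map c v = origin"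
  by (simp add: cell_map_eq_origin Bdry_def)

lemma sumsq_Disc_Bdry: "v \<in> Disc p - Bdry p \<Longrightarrow> sumsq p v < 1"
  by (auto simp: Disc_def Bdry_def)

text \<open>The height coordinate \<open>1 - sumsq\<close> determines the norm; inside the open disc
  it is positive and can be divided out of the remaining slots.\<close>

lemma inj_on_cell_map: "inj_on (cell_map c) (Disc (fst c) - Bdry (fst c))"
proof (rule inj_onI)
  fix v w assume v: "v \<in> Disc (fst c) - Bdry (fst c)" and w: "w \<in> Disc (fst c) - Bdry (fst c)"
    and eq: "cell_map c v = cell_map c w"
  have h: "sumsq (fst c) v = sumsq (fst c) w"
    using fun_cong[OF eq, of "blk c (fst c)"] sumsq_Disc_Bdry[OF v] sumsq_Disc_Bdry[OF w]
    by (simp add: cell_map_height)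
  have "v i = w i" for i
  proof (cases "i < fst c")
    case True
    then show ?thesis using fun_cong[OF eq, of "blk c i"] sumsq_Disc_Bdry[OF w] h
      by (simp add: cell_map_def)
  next
    case False
    then show ?thesis using v w by (simp add: Disc_def)
  qed
  then show "v = w" by (simp add: fun_eq_iff)
qed

lemma cell_map_disjoint:
  assumes "cell_map c v = cell_map d w" "cell_map c v \<noteq> origin" shows "c = d"
proof (rule ccontr)
  assume "c \<noteq> d"
  have "cell_map c v m = 0" for m
    using \<open>c \<noteq> d\<close> assms(1) by (metis cell_map_other)
  then show False using assms(2) by (simp add: fun_eq_iff)
qed

text \<open>The tip is inserted separately, so that the empty wedge is the 0-cell and not the empty
  set.\<close>

definition wedge :: "cell set \<Rightarrow> (nat \<Rightarrow> real) set" where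
  "wedge C = insert origin (\<Union>c\<in>C. cell_map c ` Disc (fst c))"

lemma origin_in_wedge [simp]: "origin \<in> wedge C"
  by (simp add: wedge_def)

lemma wedge_empty [simp]: "wedge {} = {origin}"
  by (simp add: wedge_def)

lemma wedge_insert: "wedge (insert c C) = wedge C \<union> cell_map c ` Disc (fst c)"
  by (auto simp: wedge_def)

lemma wedge_mono: "C \<subseteq> D \<Longrightarrow> wedge C \<subseteq> wedge D"
  by (auto simp: wedge_def)

lemma cell_map_in_wedge:
  assumes "c \<in> C" "\<forall>i\<ge>fst c. v i = 0" shows "cell_map c v \<in> wedge C"
proof (cases "sumsq (fst c) v \<le> 1")
  case True
  then show ?thesis using assms by (auto simp: wedge_def Disc_def)
next
  case False
  then have "cell_map c v = origin" by (simp add: cell_map_eq_origin)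
  then show ?thesis by simp
qed

lemma cell_map_Disc_in_wedge: "c \<in> C \<Longrightarrow> v \<in> Disc (fst c) \<Longrightarrow> cell_map c v \<in> wedge C"
  by (simp add: cell_map_in_wedge Disc_def)

lemma wedge_cases:
  assumes "x \<in> wedge C"
  obtains "x = origin" | c v where "c \<in> C" "v \<in> Disc (fst c) - Bdry (fst c)" "x = cell_map c v"
  using assms cell_map_Bdry by (fastforce simp: wedge_def)

lemma compact_wedge: "finite C \<Longrightarrow> compact (wedge C)"
  unfolding wedge_def
  by (intro compact_insert compact_UN compact_continuous_image continuous_on_cell_map compact_Disc
      continuous_on_id) auto

lemma cell_map_notin_wedge:
  assumes "c \<notin> C" "v \<in> Disc (fst c) - Bdry (fst c)" shows "cell_map c v \<notin> wedge C"
proof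
  assume "cell_map c v \<in> wedge C"
  moreover have ne: "cell_map c v \<noteq> origin"
    using sumsq_Disc_Bdry[OF assms(2)] by (simp add: cell_map_eq_origin)
  ultimately obtain d w where "d \<in> C" "cell_map c v = cell_map d w"
    by (auto elim: wedge_cases)
  then show False using cell_map_disjoint[OF _ ne] assms(1) by metis
qed

lemma cell_attachment_wedge:
  assumes "finite C" "c \<notin> C"
  shows "cell_attachment (wedge (insert c C)) (wedge C) (fst c) (cell_map c)"
proof
  show "continuous_on (Disc (fst c)) (cell_map c)"
    using continuous_on_cell_map[OF continuous_on_id] .
  show "wedge (insert c C) = wedge C \<union> cell_map c ` Disc (fst c)" by (rule wedge_insert)
  show "closed (wedge C)" using assms(1) by (intro compact_imp_closed compact_wedge)
  show "cell_map c ` Bdry (fst c) \<subseteq> wedge C" by (auto simp: cell_map_Bdry)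
  show "inj_on (cell_map c) (Disc (fst c) - Bdry (fst c))" by (rule inj_on_cell_map)
  show "cell_map c ` (Disc (fst c) - Bdry (fst c)) \<inter> wedge C = {}"
    using cell_map_notin_wedge[OF assms(2)] by blast
qed

text \<open>The universal property of the wedge: a map out of it, assembled from one map
  \<open>\<phi> c\<close> for each cell. It restricts to \<open>\<phi> c\<close> on a cell as soon
  as \<open>\<phi> c\<close> has the constant value \<open>b\<close> on the boundary sphere.\<close>

definition wedge_lift :: "'b \<Rightarrow> (cell \<Rightarrow> (nat \<Rightarrow> real) \<Rightarrow> 'b) \<Rightarrow> (nat \<Rightarrow> real) \<Rightarrow> 'b" where
  "wedge_lift b \<phi> x = (if x = origin then b else
     (let c = THE c. \<exists>v\<in>Disc (fst c) - Bdry (fst c). x = cell_map c v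
      in \<phi> c (inv_into (Disc (fst c) - Bdry (fst c)) (cell_map c) x)))"

lemma wedge_lift_origin [simp]: "wedge_lift b \<phi> origin = b"
  by (simp add: wedge_lift_def)

lemma wedge_lift_cell:
  assumes v: "v \<in> Disc (fst c)" and b: "\<phi> c ` Bdry (fst c) \<subseteq> {b}"
  shows "wedge_lift b \<phi> (cell_map c v) = \<phi> c v"
proof (cases "v \<in> Bdry (fst c)")
  case True
  then show ?thesis using b by (auto simp: cell_map_Bdry)
next
  case False
  then have v': "v \<in> Disc (fst c) - Bdry (fst c)" using v by simp
  have ne: "cell_map c v \<noteq> origin"
    using sumsq_Disc_Bdry[OF v'] by (simp add: cell_map_eq_origin)
  have "(THE d. \<exists>w\<in>Disc (fst d) - Bdry (fst d). cell_map c v = cell_map d w) = c"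
    using v' ne cell_map_disjoint by (intro the_equality) (blast, metis)
  then show ?thesis using ne v' inj_on_cell_map by (simp add: wedge_lift_def)
qed

lemma continuous_on_wedge:
  fixes f :: "(nat \<Rightarrow> real) \<Rightarrow> 'b::topological_space"
  assumes "finite C" "\<And>c. c \<in> C \<Longrightarrow> continuous_on (Disc (fst c)) (\<lambda>v. f (cell_map c v))"
  shows "continuous_on (wedge C) f"
  using assms
proof (induction C rule: finite_induct)
  case (insert c C)
  show ?case unfolding wedge_insert
  proof (rule continuous_on_closed_Un)
    have cm: "continuous_on (Disc (fst c)) (cell_map c)"
      using continuous_on_cell_map[OF continuous_on_id] .
    show "closed (wedge C)" using insert by (intro compact_imp_closed compact_wedge)
    show "closed (cell_map c ` Disc (fst c))"
      by (intro compact_imp_closed compact_continuous_image cm compact_Disc)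
    show "continuous_on (wedge C) f" using insert by auto
    show "continuous_on (cell_map c ` Disc (fst c)) f"
      by (rule continuous_on_compact_quotient[OF compact_Disc cm]) (use insert in auto)
  qed
qed simp

lemma continuous_on_wedge_lift:
  fixes b :: "'b::topological_space"
  assumes "finite C" "\<And>c. c \<in> C \<Longrightarrow> continuous_on (Disc (fst c)) (\<phi> c)"
    and "\<And>c. c \<in> C \<Longrightarrow> \<phi> c ` Bdry (fst c) \<subseteq> {b}"
  shows "continuous_on (wedge C) (wedge_lift b \<phi>)"
proof (rule continuous_on_wedge[OF assms(1)])
  fix c assume c: "c \<in> C"
  show "continuous_on (Disc (fst c)) (\<lambda>v. wedge_lift b \<phi> (cell_map c v))"
    using assms(2)[OF c] by (rule continuous_on_eq) (simp add: wedge_lift_cell assms(3)[OF c])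
qed

text \<open>On a wedge this collapses every cell outside \<open>K\<close> to the tip, a retraction
  onto the subwedge. As a coordinate projection it is continuous on the whole type.\<close>

definition keep :: "cell set \<Rightarrow> (nat \<Rightarrow> real) \<Rightarrow> nat \<Rightarrow> real" where
  "keep K x = (\<lambda>m. if cell_of m \<in> K then x m else 0)"

lemma keep_origin [simp]: "keep K origin = origin"
  by (simp add: keep_def)

lemma keep_cell_map: "keep K (cell_map c v) = (if c \<in> K then cell_map c v else origin)"
  by (auto simp: keep_def fun_eq_iff cell_map_def)

lemma keep_wedge: "x \<in> wedge C \<Longrightarrow> keep K x \<in> wedge (C \<inter> K)"
  by (erule wedge_cases) (auto simp: keep_cell_map intro: cell_map_Disc_in_wedge)

lemma keep_id: "x \<in> wedge C \<Longrightarrow> C \<subseteq> K \<Longrightarrow> keep K x = x"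
  by (auto simp: wedge_def keep_cell_map)

lemma continuous_on_keep: "continuous_on S (keep K)"
proof -
  have "continuous_on S (\<lambda>x. if cell_of m \<in> K then x m else 0)" for m
    using continuous_on_app[OF continuous_on_id, of S m] by (cases "cell_of m \<in> K") auto
  then show ?thesis unfolding keep_def by (rule continuous_on_coordinatewise_then_product)
qed

section \<open>Classes represented by maps of discs\<close>

text \<open>The injective half of the splitting of the homology of a wedge of two spheres. If the
  collapse to \<open>d\<close> kills \<open>z\<close>, then \<open>z\<close> dies relative to the
  sphere of \<open>c\<close> and therefore comes from that sphere, where the collapse to
  \<open>c\<close> is a left inverse of the inclusion.\<close>

lemma wedge_pair_joint_inj:
  assumes cd: "c \<noteq> d"
    and z: "z \<in> carrier (relative_homology_group q (top_of_set (wedge {c, d})) {origin})"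
    and zc: "hom_induced q (top_of_set (wedge {c, d})) {origin} (top_of_set (wedge {c})) {origin} (keep {c}) z
      = \<one>\<^bsub>relative_homology_group q (top_of_set (wedge {c})) {origin}\<^esub>"
    and zd: "hom_induced q (top_of_set (wedge {c, d})) {origin} (top_of_set (wedge {d})) {origin} (keep {d}) z
      = \<one>\<^bsub>relative_homology_group q (top_of_set (wedge {d})) {origin}\<^esub>"
  shows "z = \<one>\<^bsub>relative_homology_group q (top_of_set (wedge {c, d})) {origin}\<^esub>"
proof -
  interpret P: cell_attachment "wedge {c, d}" "wedge {c}" "fst d" "cell_map d"
    using cell_attachment_wedge[of "{c}" d] cd by (simp add: insert_commute)
  interpret S: cell_attachment "wedge {d}" "{origin}" "fst d" "cell_map d"
    using cell_attachment_wedge[of "{}" d] by simp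
  let ?W = "top_of_set (wedge {c, d})" and ?C = "top_of_set (wedge {c})" and ?T = "top_of_set (wedge {d})"
  let ?D = "top_of_set (Disc (fst d))" and ?B = "Bdry (fst d)"
  let ?H = "relative_homology_group q"
  let ?j = "hom_induced q ?W {origin} ?W (wedge {c}) id"
  have kd: "continuous_map ?W ?T (keep {d})" and kc: "continuous_map ?W ?C (keep {c})"
    using continuous_on_keep keep_wedge[of _ "{c, d}" "{d}"] keep_wedge[of _ "{c, d}" "{c}"] by auto
  have kdc: "keep {d} \<in> wedge {c} \<rightarrow> {origin}"
    using keep_wedge[of _ "{c}" "{d}"] cd by auto
  have cmd: "continuous_map ?D ?W (cell_map d)"
    using continuous_on_cell_map[OF continuous_on_id] cell_map_Disc_in_wedge by auto
  have cmb: "cell_map d \<in> ?B \<rightarrow> wedge {c}" by (auto simp: cell_map_Bdry)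
  \<comment> \<open>Relative to the sphere of \<open>c\<close>, only the cell \<open>d\<close> is
    left, so the class comes from the disc.\<close>
  have "?j z \<in> hom_induced q ?D ?B ?W (wedge {c}) (cell_map d) ` carrier (?H ?D ?B)"
    using P.iso_cell[of q] by (simp add: iso_def bij_betw_def hom_induced_carrier)
  then obtain y where y: "y \<in> carrier (?H ?D ?B)" "?j z = hom_induced q ?D ?B ?W (wedge {c}) (cell_map d) y"
    by (rule imageE)
  have "hom_induced q ?D ?B ?T {origin} (cell_map d) y
      = hom_induced q ?D ?B ?T {origin} (keep {d} \<circ> cell_map d) y"
    by (rule fun_cong, rule hom_induced_eq) (simp add: keep_cell_map)
  also have "\<dots> = hom_induced q ?W (wedge {c}) ?T {origin} (keep {d}) (?j z)"
    unfolding y(2) by (rule hom_induced_compose'[symmetric, OF cmd cmb kd kdc])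
  also have "\<dots> = hom_induced q ?W {origin} ?T {origin} (keep {d} \<circ> id) z"
    by (rule hom_induced_compose') (use kd kdc in auto)
  also have "\<dots> = \<one>\<^bsub>?H ?T {origin}\<^esub>" using zd by simp
  finally have "hom_induced q ?D ?B ?T {origin} (cell_map d) y = \<one>\<^bsub>?H ?T {origin}\<^esub>" .
  moreover interpret h: group_hom "?H ?D ?B" "?H ?T {origin}" "hom_induced q ?D ?B ?T {origin} (cell_map d)"
    by (rule group_homI) (auto simp: hom_induced_hom)
  have "inj_on (hom_induced q ?D ?B ?T {origin} (cell_map d)) (carrier (?H ?D ?B))"
    using S.iso_cell[of q] by (auto simp: iso_def bij_betw_def)
  ultimately have "y = \<one>\<^bsub>?H ?D ?B\<^esub>"
    using y(1) h.G.one_closed h.hom_one by (metis inj_onD)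
  then have "?j z = \<one>\<^bsub>?H ?W (wedge {c})\<^esub>"
    unfolding y(2) by (simp add: hom_one[OF hom_induced_hom])
  moreover have sub: "wedge {c, d} \<inter> wedge {c} = wedge {c}" using wedge_mono[of "{c}" "{c, d}"] by auto
  \<comment> \<open>Exactness for the triple of the wedge, the sphere of \<open>c\<close> and the
    tip.\<close>
  have "exact_seq ([?H ?W (wedge {c}), ?H ?W {origin}, ?H ?C {origin}],
      [?j, hom_induced q ?C {origin} ?W {origin} id])"
    using homology_exactness_triple_3[of "{origin}" "wedge {c}" q ?W]
    by (simp add: subtopology_subtopology sub)
  then have "hom_induced q ?C {origin} ?W {origin} id ` carrier (?H ?C {origin}) = kernel (?H ?W {origin}) (?H ?W (wedge {c})) ?j"
    by simp
  ultimately obtain x where x: "x \<in> carrier (?H ?C {origin})" "z = hom_induced q ?C {origin} ?W {origin} id x"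
    using z unfolding kernel_def by blast
  have "x = hom_induced q ?C {origin} ?C {origin} (keep {c} \<circ> id) x"
    using x(1) kc continuous_on_keep keep_wedge[of _ "{c}" "{c}"]
    by (intro hom_induced_id_gen[symmetric]) (auto simp: keep_id[of _ "{c}"])
  also have "\<dots> = hom_induced q ?W {origin} ?C {origin} (keep {c}) z"
    unfolding x(2) by (rule hom_induced_compose'[symmetric]) (use kc wedge_mono[of "{c}" "{c, d}"] in auto)
  also have "\<dots> = \<one>\<^bsub>?H ?C {origin}\<^esub>" by (rule zc)
  finally show ?thesis unfolding x(2) by (simp add: hom_one[OF hom_induced_hom])
qed

section \<open>Pinching a disc adds the two halves\<close>

lemma sumsq_affine:
  assumes "1 \<le> p"
  shows "sumsq p (\<lambda>i. a * v i + (if i = 0 then b else 0)) = a\<^sup>2 * sumsq p v + 2 * a * b * v 0 + b\<^sup>2"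
proof -
  obtain n where n: "p = Suc n" using assms by (cases p) auto
  show ?thesis
    unfolding sumsq_def n sum.lessThan_Suc_shift
    by (simp add: power2_sum power_mult_distrib sum_distrib_left algebra_simps)
qed

lemma Bdry_first_coordinate:
  assumes "1 \<le> p" "v \<in> Bdry p" shows "\<bar>v 0\<bar> \<le> 1"
proof -
  have "(v 0)\<^sup>2 \<le> sumsq p v"
    unfolding sumsq_def using assms(1) by (intro member_le_sum) auto
  then show ?thesis using assms(2) by (simp add: Bdry_def abs_square_le_1)
qed

text \<open>For \<open>e = 1\<close> or \<open>e = -1\<close>, \<open>slide e\<close> deforms the identity to $v \mapsto 2v + e\,e_0$, which expands
  a disc of radius $1/2$ in one half of the unit disc to the whole disc; the boundary stays
  outside the open disc throughout.\<close>

definition slide :: "real \<Rightarrow> real \<Rightarrow> (nat \<Rightarrow> real) \<Rightarrow> nat \<Rightarrow> real" where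
  "slide e t v = (\<lambda>i. (1 + t) * v i + (if i = 0 then e * t else 0))"

lemma slide_0 [simp]: "slide e 0 v = v"
  by (simp add: slide_def fun_eq_iff)

text \<open>For \<open>|v| = 1\<close> the square norm is
  \<open>(1+t)^2 + 2(1+t)t e v_0 + t^2\<close>. Since \<open>e v_0\<close> is at least -1, this is
  at least \<open>((1+t) - t)^2 = 1\<close>.\<close>

lemma sumsq_slide_Bdry:
  assumes "1 \<le> p" "v \<in> Bdry p" "0 \<le> t" "\<bar>e\<bar> = 1" shows "1 \<le> sumsq p (slide e t v)"
proof -
  have e: "e\<^sup>2 = 1" using assms(4) by (metis power2_abs one_power2)
  have "\<bar>e * v 0\<bar> \<le> 1" using Bdry_first_coordinate[OF assms(1,2)] assms(4) by (simp add: abs_mult)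
  then have "-1 \<le> e * v 0" by linarith
  then have "2 * (1 + t) * t * (-1) \<le> 2 * (1 + t) * t * (e * v 0)"
    using assms(3) by (intro mult_left_mono) auto
  moreover have "sumsq p (slide e t v) = (1 + t)\<^sup>2 + 2 * (1 + t) * t * (e * v 0) + t\<^sup>2"
    unfolding slide_def sumsq_affine[OF assms(1)] using assms(2) e
    by (simp add: Bdry_def power_mult_distrib algebra_simps)
  ultimately show ?thesis by (simp add: power2_eq_square algebra_simps)
qed

lemma slide_zero_from: "1 \<le> p \<Longrightarrow> v \<in> Disc p \<Longrightarrow> \<forall>i\<ge>p. slide e t v i = 0"
  by (auto simp: slide_def Disc_def)

lemma continuous_on_slide:
  assumes "continuous_on S t" "continuous_on S f"
  shows "continuous_on S (\<lambda>x. slide e (t x) (f x))"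
  unfolding slide_def
proof (rule continuous_on_coordinatewise_then_product)
  fix i
  have "continuous_on S (\<lambda>x. f x i)" using assms(2) by (rule continuous_on_app)
  then show "continuous_on S (\<lambda>x. (1 + t x) * f x i + (if i = 0 then e * t x else 0))"
    using assms(1) by (cases "i = 0") (auto intro!: continuous_intros)
qed

text \<open>On the disc at most one summand differs from the origin, so the sum is really a case
  distinction that is visibly continuous. The two cells receive the open balls of radius 1/2 about
  \<open>-e_0/2\<close> and \<open>e_0/2\<close>.\<close>

definition pinch :: "nat \<Rightarrow> (nat \<Rightarrow> real) \<Rightarrow> nat \<Rightarrow> real" where
  "pinch p v = (\<lambda>m. cell_map (p, 0) (slide 1 1 v) m + cell_map (p, 1) (slide (-1) 1 v) m)"

lemma keep_pinch:
  "keep {(p, 0)} (pinch p v) = cell_map (p, 0) (slide 1 1 v)"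
  "keep {(p, 1)} (pinch p v) = cell_map (p, 1) (slide (-1) 1 v)"
  by (auto simp: keep_def pinch_def cell_map_def fun_eq_iff)

text \<open>Parallelogram law: \<open>|2v + e_0|^2 + |2v - e_0|^2 = 8|v|^2 + 2\<close>, so the two
  points cannot both lie in the open unit disc.\<close>

lemma pinch_in_wedge:
  assumes p: "1 \<le> p" and v: "v \<in> Disc p"
  shows "pinch p v \<in> wedge {(p, 0), (p, 1)}"
proof -
  have "sumsq p (slide 1 1 v) + sumsq p (slide (-1) 1 v) = 8 * sumsq p v + 2"
    unfolding slide_def sumsq_affine[OF p] by simp
  then have "sumsq p (slide 1 1 v) + sumsq p (slide (-1) 1 v) \<ge> 2" by simp
  then consider "1 \<le> sumsq p (slide 1 1 v)" | "1 \<le> sumsq p (slide (-1) 1 v)" by linarith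
  then show ?thesis
  proof cases
    case 1
    then have "cell_map (p, 0) (slide 1 1 v) = origin" by (simp add: cell_map_eq_origin)
    then have "pinch p v = cell_map (p, 1) (slide (-1) 1 v)" by (simp add: pinch_def)
    then show ?thesis using slide_zero_from[OF p v] by (simp add: cell_map_in_wedge)
  next
    case 2
    then have "cell_map (p, 1) (slide (-1) 1 v) = origin" by (simp add: cell_map_eq_origin)
    then have "pinch p v = cell_map (p, 0) (slide 1 1 v)" by (simp add: pinch_def)
    then show ?thesis using slide_zero_from[OF p v] by (simp add: cell_map_in_wedge)
  qed
qed

lemma pinch_Bdry: "1 \<le> p \<Longrightarrow> v \<in> Bdry p \<Longrightarrow> pinch p v = origin"
  using sumsq_slide_Bdry[of p v 1 1] sumsq_slide_Bdry[of p v 1 "-1"]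
    cell_map_eq_origin[of "(p, 0)" "slide 1 1 v"] cell_map_eq_origin[of "(p, 1)" "slide (-1) 1 v"]
  by (simp add: pinch_def)

lemma continuous_on_pinch: "continuous_on S (pinch p)"
  unfolding pinch_def
proof (rule continuous_on_coordinatewise_then_product)
  fix m
  have "continuous_on S (\<lambda>v. cell_map c (slide e 1 v) m)" for c e
    by (rule continuous_on_app, rule continuous_on_cell_map, rule continuous_on_slide)
       (auto intro: continuous_intros)
  then show "continuous_on S (\<lambda>v. cell_map (p, 0) (slide 1 1 v) m + cell_map (p, 1) (slide (-1) 1 v) m)"
    by (intro continuous_on_add)
qed

text \<open>Collapsing one sphere turns \<open>pinch\<close> into a single slid cell map. Sliding
  back is a homotopy of pairs, as boundary points stay outside the open disc and hence at the
  tip.\<close>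

lemma slide_homotopic:
  assumes p: "1 \<le> fst c" and e: "\<bar>e\<bar> = 1"
  shows "hom_induced q (top_of_set (Disc (fst c))) (Bdry (fst c)) (top_of_set (wedge {c})) {origin} (\<lambda>v. cell_map c (slide e 1 v))
    = hom_induced q (top_of_set (Disc (fst c))) (Bdry (fst c)) (top_of_set (wedge {c})) {origin} (cell_map c)"
proof (rule homology_homotopy_axiom, subst homotopic_with_sym,
    rule homotopic_with_top_of_setI[of _ "\<lambda>t v. cell_map c (slide e t v)"])
  show "continuous_on ({0..1} \<times> Disc (fst c)) (\<lambda>z. cell_map c (slide e (fst z) (snd z)))"
    by (intro continuous_on_cell_map continuous_on_slide continuous_intros)
  show "cell_map c (slide e t v) \<in> wedge {c}" if "v \<in> Disc (fst c)" for t v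
    using slide_zero_from[OF p that] by (simp add: cell_map_in_wedge)
  show "cell_map c (slide e t v) \<in> {origin}" if "0 \<le> t" "v \<in> Bdry (fst c)" for t v
    using sumsq_slide_Bdry[OF p that(2,1) e] by (simp add: cell_map_eq_origin)
qed (use Bdry_subset_Disc in auto)

text \<open>The quotient \<open>w\<close> of the two sides dies under both collapses: a collapse
  turns the pinch map into the remaining cell map up to homotopy and makes the other cell map
  constant. Joint injectivity of the collapses finishes the proof.\<close>

lemma pinch_class:
  assumes p: "1 \<le> p" and z: "z \<in> carrier (relative_homology_group q (top_of_set (Disc p)) (Bdry p))"
  defines "G \<equiv> relative_homology_group q (top_of_set (wedge {(p, 0), (p, 1)})) {origin}"
    and "I \<equiv> hom_induced q (top_of_set (Disc p)) (Bdry p) (top_of_set (wedge {(p, 0), (p, 1)})) {origin}"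
  shows "I (pinch p) z = I (cell_map (p, 0)) z \<otimes>\<^bsub>G\<^esub> I (cell_map (p, 1)) z"
proof -
  let ?W = "top_of_set (wedge {(p, 0), (p, 1)})" and ?D = "top_of_set (Disc p)"
  interpret G: comm_group G by (simp add: G_def)
  let ?c = "\<lambda>k :: nat. (p, k)"
  let ?T = "\<lambda>k. top_of_set (wedge {?c k})"
  let ?K = "\<lambda>k. relative_homology_group q (?T k) {origin}"
  let ?k = "\<lambda>k. hom_induced q ?W {origin} (?T k) {origin} (keep {?c k})"
  let ?I = "\<lambda>k. hom_induced q ?D (Bdry p) (?T k) {origin}"
  define w where "w = I (pinch p) z \<otimes>\<^bsub>G\<^esub> inv\<^bsub>G\<^esub> (I (cell_map (?c 0)) z \<otimes>\<^bsub>G\<^esub> I (cell_map (?c 1)) z)"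
  have Ic: "I f z \<in> carrier G" for f by (simp add: I_def G_def hom_induced_carrier)
  have cm: "continuous_map ?D ?W (cell_map (?c k))" if "k = 0 \<or> k = 1" for k
    using continuous_on_cell_map[OF continuous_on_id] cell_map_Disc_in_wedge[of "?c k"] that by auto
  have cp: "continuous_map ?D ?W (pinch p)"
    using continuous_on_pinch pinch_in_wedge[OF p] by auto
  have b: "cell_map (?c k) \<in> Bdry p \<rightarrow> {origin}" for k
    using cell_map_Bdry[of _ "?c k"] by auto
  have bp: "pinch p \<in> Bdry p \<rightarrow> {origin}" using pinch_Bdry[OF p] by auto
  have kc: "continuous_map ?W (?T k) (keep {?c k})" if "k = 0 \<or> k = 1" for k
    using that continuous_on_keep keep_wedge[of _ "{?c 0, ?c 1}" "{?c k}"] by auto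
  have comp: "?k k (I f z) = ?I k (keep {?c k} \<circ> f) z"
    if "k = 0 \<or> k = 1" "continuous_map ?D ?W f" "f \<in> Bdry p \<rightarrow> {origin}" for k f
    unfolding I_def by (rule hom_induced_compose'[OF that(2,3) kc[OF that(1)]]) simp
  have kk: "?k k (I (cell_map (?c l)) z) = (if k = l then ?I k (cell_map (?c k)) z else \<one>\<^bsub>?K k\<^esub>)"
    if "k = 0 \<or> k = 1" "l = 0 \<or> l = 1" for k l
  proof (cases "k = l")
    case True
    have "?I k (keep {?c k} \<circ> cell_map (?c k)) z = ?I k (cell_map (?c k)) z"
      by (rule fun_cong, rule hom_induced_eq) (simp add: keep_cell_map)
    then show ?thesis using comp[OF that(1) cm[OF that(2)] b] True by simp
  next
    case False
    have "?I k (keep {?c k} \<circ> cell_map (?c l)) z = \<one>\<^bsub>?K k\<^esub>"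
    proof (rule hom_induced_into_subspace)
      show "continuous_map ?D (?T k) (keep {?c k} \<circ> cell_map (?c l))"
        by (rule continuous_map_compose[OF cm[OF that(2)] kc[OF that(1)]])
      show "(keep {?c k} \<circ> cell_map (?c l)) ` topspace ?D \<subseteq> {origin}"
        using False by (auto simp: keep_cell_map)
    qed
    then show ?thesis using comp[OF that(1) cm[OF that(2)] b] False by simp
  qed
  have kp: "?k k (I (pinch p) z) = ?I k (cell_map (?c k)) z" if k: "k = 0 \<or> k = 1" for k
  proof -
    obtain e where e: "\<bar>e\<bar> = 1" "\<And>v. keep {?c k} (pinch p v) = cell_map (?c k) (slide e 1 v)"
      using k keep_pinch[of p] by (metis abs_1 abs_minus_cancel)
    have "?k k (I (pinch p) z) = ?I k (keep {?c k} \<circ> pinch p) z" by (rule comp[OF k cp bp])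
    also have "keep {?c k} \<circ> pinch p = (\<lambda>v. cell_map (?c k) (slide e 1 v))" using e(2) by auto
    also have "?I k \<dots> z = ?I k (cell_map (?c k)) z"
      using slide_homotopic[of "?c k" e q] p e(1) by simp
    finally show ?thesis .
  qed
  have hom: "group_hom G (?K k) (?k k)" for k
    unfolding G_def by (rule group_homI) (auto simp: hom_induced_hom)
  have kw: "?k k w = \<one>\<^bsub>?K k\<^esub>" if k: "k = 0 \<or> k = 1" for k
  proof -
    interpret h: group_hom G "?K k" "?k k" by (rule hom)
    have "?k k w = ?k k (I (pinch p) z) \<otimes>\<^bsub>?K k\<^esub> inv\<^bsub>?K k\<^esub> (?k k (I (cell_map (?c 0)) z) \<otimes>\<^bsub>?K k\<^esub> ?k k (I (cell_map (?c 1)) z))"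
      unfolding w_def using Ic by (simp del: One_nat_def)
    also have "?k k (I (cell_map (?c 0)) z) \<otimes>\<^bsub>?K k\<^esub> ?k k (I (cell_map (?c 1)) z) = ?I k (cell_map (?c k)) z"
      using kk[OF k, of 0] kk[OF k, of 1] k h.H.r_one[OF hom_induced_carrier] h.H.l_one[OF hom_induced_carrier]
      by (elim disjE) (simp_all del: One_nat_def)
    finally show ?thesis unfolding kp[OF k] by (simp add: hom_induced_carrier)
  qed
  have "w \<in> carrier G" unfolding w_def using Ic by simp
  then have "w = \<one>\<^bsub>G\<^esub>"
    using wedge_pair_joint_inj[of "?c 0" "?c 1" w q] kw[of 0] kw[of 1] by (simp add: G_def)
  then show ?thesis unfolding w_def using Ic by (simp add: G.inv_solve_right')
qed

text \<open>Essentially the image of the p-th homotopy group of \<open>Z\<close> at \<open>b\<close>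
  under the Hurewicz map, followed by passage to homology relative to \<open>B\<close>. Asking for
  the single value \<open>b\<close> on the boundary, not just a value in \<open>B\<close>, is what
  allows such maps to be glued by \<open>wedge_lift\<close>.\<close>

definition realizable :: "nat \<Rightarrow> 'a::topological_space set \<Rightarrow> 'a set \<Rightarrow> 'a \<Rightarrow> 'a chain set set" where
  "realizable p Z B b = {hom_induced (int p) (disc p) (disc_boundary p) (top_of_set Z) B \<phi> (disc_generator p) |\<phi>.
     continuous_on (Disc p) \<phi> \<and> \<phi> ` Disc p \<subseteq> Z \<and> \<phi> ` Bdry p \<subseteq> {b}}"

text \<open>Precomposition with \<open>flip\<close> realizes inverses; pinching the disc and mapping
  the two spheres by \<open>\<phi>\<close> and \<open>\<psi>\<close> realizes products. Both
  constructions use a coordinate 0, hence \<open>1 \<le> p\<close>.\<close>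

lemma subgroup_realizable:
  assumes p: "1 \<le> p" and b: "b \<in> B" "b \<in> Z"
  shows "subgroup (realizable p Z B b) (relative_homology_group (int p) (top_of_set Z) B)"
proof -
  let ?G = "relative_homology_group (int p) (top_of_set Z) B"
  let ?\<zeta> = "disc_generator p"
  let ?D = "top_of_set (Disc p)"
  let ?I = "hom_induced (int p) ?D (Bdry p) (top_of_set Z) B"
  interpret G: group ?G by simp
  note z = disc_generator_carrier[of p, unfolded disc_eq disc_boundary_eq]
  have R: "realizable p Z B b = {?I \<phi> ?\<zeta> |\<phi>.
     continuous_on (Disc p) \<phi> \<and> \<phi> ` Disc p \<subseteq> Z \<and> \<phi> ` Bdry p \<subseteq> {b}}"
    by (simp add: realizable_def disc_eq disc_boundary_eq)
  show ?thesis
  proof (rule G.subgroupI)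
    show "realizable p Z B b \<subseteq> carrier ?G"
      unfolding R by (auto simp: hom_induced_carrier)
    have "?I (\<lambda>_. b) ?\<zeta> \<in> realizable p Z B b"
      unfolding R using b by (intro CollectI exI[of _ "\<lambda>_. b"]) auto
    then show "realizable p Z B b \<noteq> {}" by blast
  next
    fix x assume "x \<in> realizable p Z B b"
    then obtain \<phi> where \<phi>: "continuous_on (Disc p) \<phi>" "\<phi> ` Disc p \<subseteq> Z" "\<phi> ` Bdry p \<subseteq> {b}" "x = ?I \<phi> ?\<zeta>"
      unfolding R by blast
    have fc: "continuous_map ?D ?D flip"
      using continuous_on_flip[OF continuous_on_id] flip_Disc[OF p] by auto
    have "?I (\<phi> \<circ> flip) ?\<zeta> = ?I \<phi> (hom_induced (int p) ?D (Bdry p) ?D (Bdry p) flip ?\<zeta>)"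
      by (rule hom_induced_compose'[symmetric, OF fc]) (use \<phi> b flip_Bdry[OF p] in auto)
    also have "\<dots> = ?I \<phi> (inv\<^bsub>relative_homology_group (int p) ?D (Bdry p)\<^esub> ?\<zeta>)"
      using hom_induced_flip[OF p disc_generator_carrier] by (simp add: disc_eq disc_boundary_eq)
    also have "\<dots> = inv\<^bsub>?G\<^esub> x"
      unfolding \<phi>(4) by (rule group_hom.hom_inv[OF group_homI z]) (auto simp: hom_induced_hom)
    finally have "inv\<^bsub>?G\<^esub> x = ?I (\<phi> \<circ> flip) ?\<zeta>" by simp
    moreover have "continuous_on (Disc p) (\<phi> \<circ> flip)" "(\<phi> \<circ> flip) ` Disc p \<subseteq> Z" "(\<phi> \<circ> flip) ` Bdry p \<subseteq> {b}"
      using \<phi> flip_Bdry[OF p] flip_Disc[OF p] continuous_on_compose2[OF \<phi>(1) continuous_on_flip[OF continuous_on_id]]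
      by (auto simp: o_def image_subset_iff)
    ultimately show "inv\<^bsub>?G\<^esub> x \<in> realizable p Z B b" unfolding R by blast
  next
    fix x y assume "x \<in> realizable p Z B b" "y \<in> realizable p Z B b"
    then obtain \<phi> \<psi> where \<phi>: "continuous_on (Disc p) \<phi>" "\<phi> ` Disc p \<subseteq> Z" "\<phi> ` Bdry p \<subseteq> {b}" "x = ?I \<phi> ?\<zeta>"
      and \<psi>: "continuous_on (Disc p) \<psi>" "\<psi> ` Disc p \<subseteq> Z" "\<psi> ` Bdry p \<subseteq> {b}" "y = ?I \<psi> ?\<zeta>"
      unfolding R by blast
    define F where "F = wedge_lift b (\<lambda>c. if c = (p, 0) then \<phi> else \<psi>)"
    let ?W = "wedge {(p, 0), (p, 1)}"
    let ?J = "hom_induced (int p) ?D (Bdry p) (top_of_set ?W) {origin}"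
    let ?F = "hom_induced (int p) (top_of_set ?W) {origin} (top_of_set Z) B F"
    have F0: "F (cell_map (p, 0) v) = \<phi> v" and F1: "F (cell_map (p, 1) v) = \<psi> v" if "v \<in> Disc p" for v
      unfolding F_def using that \<phi>(3) \<psi>(3) by (subst wedge_lift_cell; simp)+
    have Fo: "F origin = b" by (simp add: F_def)
    have Fc: "continuous_on ?W F"
      unfolding F_def using \<phi> \<psi> by (intro continuous_on_wedge_lift) (auto simp: image_subset_iff)
    have Fim: "F ` ?W \<subseteq> Z"
      using F0 F1 Fo b \<phi>(2) \<psi>(2) by (auto simp: wedge_def image_subset_iff)
    have FM: "continuous_map (top_of_set ?W) (top_of_set Z) F" using Fc Fim by auto
    have Fb: "F \<in> {origin} \<rightarrow> B" using Fo b by auto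
    have cm: "continuous_map ?D (top_of_set ?W) (cell_map (p, k))" if "k = 0 \<or> k = 1" for k
      using continuous_on_cell_map[OF continuous_on_id] cell_map_Disc_in_wedge[of "(p, k)"] that by auto
    have bd: "cell_map (p, k) \<in> Bdry p \<rightarrow> {origin}" for k
      using cell_map_Bdry[of _ "(p, k)"] by auto
    have pc: "continuous_map ?D (top_of_set ?W) (pinch p)"
      using continuous_on_pinch pinch_in_wedge[OF p] by auto
    have pb: "pinch p \<in> Bdry p \<rightarrow> {origin}" using pinch_Bdry[OF p] by auto
    interpret F: group_hom "relative_homology_group (int p) (top_of_set ?W) {origin}" ?G ?F
      by (rule group_homI) (auto simp: hom_induced_hom)
    have "?I (F \<circ> pinch p) ?\<zeta> = ?F (?J (pinch p) ?\<zeta>)"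
      by (rule hom_induced_compose'[symmetric, OF pc pb FM Fb])
    also have "\<dots> = ?F (?J (cell_map (p, 0)) ?\<zeta>) \<otimes>\<^bsub>?G\<^esub> ?F (?J (cell_map (p, 1)) ?\<zeta>)"
      unfolding pinch_class[OF p z] by (rule F.hom_mult[OF hom_induced_carrier hom_induced_carrier])
    also have "?F (?J (cell_map (p, 0)) ?\<zeta>) = ?I (F \<circ> cell_map (p, 0)) ?\<zeta>"
      by (rule hom_induced_compose'[OF cm bd FM Fb]) simp
    also have "\<dots> = x" unfolding \<phi>(4) by (rule fun_cong, rule hom_induced_eq) (simp add: F0 del: One_nat_def)
    also have "?F (?J (cell_map (p, 1)) ?\<zeta>) = ?I (F \<circ> cell_map (p, 1)) ?\<zeta>"
      by (rule hom_induced_compose'[OF cm bd FM Fb]) simp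
    also have "\<dots> = y" unfolding \<psi>(4) by (rule fun_cong, rule hom_induced_eq) (simp add: F1 del: One_nat_def)
    finally have "x \<otimes>\<^bsub>?G\<^esub> y = ?I (F \<circ> pinch p) ?\<zeta>" by (rule sym)
    moreover have "continuous_on (Disc p) (F \<circ> pinch p)"
      using continuous_on_compose2[OF Fc continuous_on_pinch] pinch_in_wedge[OF p] by (auto simp: o_def)
    moreover have "(F \<circ> pinch p) ` Disc p \<subseteq> Z" using pinch_in_wedge[OF p] Fim by auto
    moreover have "(F \<circ> pinch p) ` Bdry p \<subseteq> {b}" using pinch_Bdry[OF p] Fo by auto
    ultimately show "x \<otimes>\<^bsub>?G\<^esub> y \<in> realizable p Z B b" unfolding R by blast
  qed
qed

section \<open>Simple connectivity\<close>

text \<open>A loop is cut into pieces that each lie in \<open>U\<close> or in \<open>V\<close>, and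
  the initial segments are compared with paths inside one of the two sets. Path connectedness of the
  intersection permits changing from one set to the other.\<close>

lemma simply_connected_Un_open:
  fixes U V :: "'a::real_normed_vector set"
  assumes opU: "openin (top_of_set (U \<union> V)) U" and opV: "openin (top_of_set (U \<union> V)) V"
    and scU: "simply_connected U" and scV: "simply_connected V"
    and pc: "path_connected (U \<inter> V)" and ne: "U \<inter> V \<noteq> {}"
  shows "simply_connected (U \<union> V)"
proof -
  let ?X = "U \<union> V"
  obtain x0 where x0: "x0 \<in> U" "x0 \<in> V" using ne by auto
  have pcX: "path_connected ?X"
    using ne scU scV by (intro path_connected_Un simply_connected_imp_path_connected)
  have null: "homotopic_paths ?X g (linepath x0 x0)"
    if g: "path g" "path_image g \<subseteq> ?X" "pathstart g = x0" "pathfinish g = x0" for g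
  proof -
    \<comment> \<open>The invariant: up to homotopy in the union, the part of \<open>g\<close> up to
      time \<open>t\<close> equals every path from \<open>x0\<close> to \<open>g t\<close> inside
      \<open>S\<close>. Quantifying over all such paths makes the choice of path irrelevant when the
      set changes.\<close>
    define P where "P = (\<lambda>t S. g t \<in> S \<longrightarrow> (\<forall>q. path q \<longrightarrow> path_image q \<subseteq> S \<longrightarrow> pathstart q = x0 \<longrightarrow>
        pathfinish q = g t \<longrightarrow> homotopic_paths ?X (subpath 0 t g) q))"
    have step: "P t A \<and> P t B"
      if AB: "{A, B} = {U, V}" and ps: "P s A" and st: "0 \<le> s" "s \<le> t" "t \<le> 1" "g ` {s..t} \<subseteq> A"
      for A B s t
    proof -
      have scA: "simply_connected A" and scB: "simply_connected B" and pcAB: "path_connected (A \<inter> B)"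
        and x0A: "x0 \<in> A" "x0 \<in> B" and AX: "A \<subseteq> ?X" "B \<subseteq> ?X"
        using AB scU scV pc x0 by (auto simp: doubleton_eq_iff Int_commute)
      note eqA = scA[unfolded simply_connected_eq_homotopic_paths]
      note eqB = scB[unfolded simply_connected_eq_homotopic_paths]
      have gs: "g s \<in> A" "g t \<in> A" using st by auto
      obtain u where u: "path u" "path_image u \<subseteq> A" "pathstart u = x0" "pathfinish u = g s"
        using simply_connected_imp_path_connected[OF scA] x0A gs unfolding path_connected_def by metis
      have su: "homotopic_paths ?X (subpath 0 s g) u" using ps gs u unfolding P_def by blast
      have sub: "path (subpath s t g)" "path_image (subpath s t g) \<subseteq> A"
        using st g by (auto simp: path_image_subpath)
      define r where "r = u +++ subpath s t g"
      have r: "path r" "path_image r \<subseteq> A" "pathstart r = x0" "pathfinish r = g t"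
        unfolding r_def using u sub by (auto simp: path_image_join subset_iff)
      have "homotopic_paths ?X (subpath 0 t g) (subpath 0 s g +++ subpath s t g)"
        using g st by (intro homotopic_paths_sym[OF homotopic_join_subpaths]) auto
      also have "homotopic_paths ?X \<dots> r"
        unfolding r_def using su sub AX by (intro homotopic_paths_join) auto
      finally have tr: "homotopic_paths ?X (subpath 0 t g) r" .
      have "P t A"
        unfolding P_def
      proof (intro impI allI)
        fix q assume q: "path q" "path_image q \<subseteq> A" "pathstart q = x0" "pathfinish q = g t"
        have "homotopic_paths A r q" using eqA r q by simp
        then have "homotopic_paths ?X r q" using AX by (auto intro: homotopic_paths_subset)
        then show "homotopic_paths ?X (subpath 0 t g) q"
          using tr by (metis homotopic_paths_trans)
      qed
      moreover have "P t B"
        unfolding P_def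
      proof (intro impI allI)
        fix q assume gB: "g t \<in> B" and q: "path q" "path_image q \<subseteq> B" "pathstart q = x0" "pathfinish q = g t"
        \<comment> \<open>A path in the intersection mediates: it is homotopic to \<open>r\<close>
          within \<open>A\<close> and to \<open>q\<close> within \<open>B\<close>.\<close>
        obtain w where w: "path w" "path_image w \<subseteq> A \<inter> B" "pathstart w = x0" "pathfinish w = g t"
          using pcAB gs gB x0A unfolding path_connected_def by (metis IntI)
        have "homotopic_paths A r w" using eqA r w by simp
        moreover have "homotopic_paths B w q" using eqB q w by simp
        ultimately have "homotopic_paths ?X r w" "homotopic_paths ?X w q"
          using AX by (auto intro: homotopic_paths_subset)
        then show "homotopic_paths ?X (subpath 0 t g) q"
          using tr by (metis homotopic_paths_trans)
      qed
      ultimately show ?thesis by blast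
    qed
    have gc: "continuous_on {0..1} g" and gim: "g ` {0..1} \<subseteq> ?X"
      using g by (auto simp: path_def path_image_def)
    have "\<exists>T. open T \<and> {0..1} \<inter> g -` S = {0..1} \<inter> T" if "openin (top_of_set ?X) S" for S
      using continuous_openin_preimage[OF gc _ that] gim by (auto simp: openin_open)
    then obtain U' V' where UV': "open U'" "{0..1} \<inter> g -` U = {0..1} \<inter> U'" "open V'" "{0..1} \<inter> g -` V = {0..1} \<inter> V'"
      using opU opV by metis
    have "{0..1} \<subseteq> ({0..1} \<inter> g -` U) \<union> ({0..1} \<inter> g -` V)" using gim by auto
    then have cover: "{0..1} \<subseteq> \<Union>{U', V'}" unfolding UV' by auto
    \<comment> \<open>A Lebesgue number of the pulled back cover gives equal subintervals that
      \<open>g\<close> maps into \<open>U\<close> or into \<open>V\<close>.\<close>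
    obtain \<delta> where \<delta>: "\<delta> > 0" "\<And>T. T \<subseteq> {0..1} \<Longrightarrow> diameter T < \<delta> \<Longrightarrow> \<exists>B\<in>{U', V'}. T \<subseteq> B"
    proof (rule Lebesgue_number_lemma[OF compact_Icc _ cover])
      show "open B" if "B \<in> {U', V'}" for B using that UV' by auto
    qed auto
    obtain N :: nat where N: "N > 0" "1 / real N < \<delta>"
      using \<delta>(1) by (metis gr_implies_not0 neq0_conv reals_Archimedean inverse_eq_divide zero_less_Suc)
    have ind: "P (real i / N) U \<and> P (real i / N) V" if "i \<le> N" for i
      using that
    proof (induction i)
      case 0
      have "P 0 S" if S: "simply_connected S" "S \<subseteq> ?X" for S
        unfolding P_def
      proof (intro impI allI)
        fix q assume q: "path q" "path_image q \<subseteq> S" "pathstart q = x0" "pathfinish q = g 0"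
        have g0: "g 0 = x0" using g by (simp add: pathstart_def)
        have "homotopic_paths S q (linepath x0 x0)"
          using S(1) q g0 unfolding simply_connected_eq_contractible_path by metis
        then have "homotopic_paths ?X (linepath x0 x0) q"
          using S(2) homotopic_paths_subset homotopic_paths_sym by blast
        moreover have "subpath 0 0 g = linepath x0 x0"
          using g0 by (simp add: subpath_def linepath_def fun_eq_iff algebra_simps)
        ultimately show "homotopic_paths ?X (subpath 0 0 g) q" by simp
      qed
      then show ?case using scU scV by simp
    next
      case (Suc i)
      let ?s = "real i / N" and ?t = "real (Suc i) / N"
      have st: "0 \<le> ?s" "?s \<le> ?t" "?t \<le> 1" using N(1) Suc.prems by (auto simp: divide_simps)
      have "?t - ?s = 1 / N" by (simp add: add_divide_distrib)
      then have "diameter {?s..?t} < \<delta>" using N(2) st by (simp add: diameter_closed_interval)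
      moreover have sub: "{?s..?t} \<subseteq> {0..1}" using st by auto
      ultimately consider "{?s..?t} \<subseteq> U'" | "{?s..?t} \<subseteq> V'" using \<delta>(2) by blast
      then show ?case
      proof cases
        case 1
        then have "g ` {?s..?t} \<subseteq> U" using UV' sub by blast
        then show ?thesis using step[of U V ?s ?t] Suc st by simp
      next
        case 2
        then have "g ` {?s..?t} \<subseteq> V" using UV' sub by blast
        then show ?thesis using step[of V U ?s ?t] Suc st by (simp add: insert_commute)
      qed
    qed
    have "P 1 U" using ind[of N] N(1) by simp
    moreover have "g 1 = x0" using g by (simp add: pathfinish_def)
    ultimately have "homotopic_paths ?X (subpath 0 1 g) (linepath x0 x0)"
      unfolding P_def using x0 by simp
    then show ?thesis by simp
  qed
  show ?thesis
    unfolding simply_connected_eq_contractible_loop_all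
  proof (intro disjI2 bexI[of _ x0] allI impI)
    fix p assume p: "path p \<and> path_image p \<subseteq> ?X \<and> pathfinish p = pathstart p"
    then have "pathstart p \<in> ?X" using pathstart_in_path_image by blast
    then obtain w where w: "path w" "path_image w \<subseteq> ?X" "pathstart w = x0" "pathfinish w = pathstart p"
      using pcX x0 unfolding path_connected_def by blast
    \<comment> \<open>Conjugation by \<open>w\<close> moves a free loop to the base point
      \<open>x0\<close>, where \<open>null\<close> applies.\<close>
    let ?c = "w +++ p +++ reversepath w"
    have "homotopic_paths ?X ?c (linepath x0 x0)"
      using p w by (intro null) (auto simp: path_image_join)
    then have "homotopic_loops ?X ?c (linepath x0 x0)"
      using p w by (intro homotopic_paths_imp_homotopic_loops) auto
    moreover have "homotopic_loops ?X p ?c"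
      using p w by (intro homotopic_loops_sym[OF homotopic_loops_conjugate]) auto
    ultimately show "homotopic_loops ?X p (linepath x0 x0)" by (metis homotopic_loops_trans)
  qed (use x0 in auto)
qed

section \<open>Spheres, annuli and the attachment of a cell\<close>

lemma path_connected_Bdry:
  assumes "2 \<le> p" shows "path_connected (Bdry p)"
proof -
  obtain n where n: "p = Suc n" "1 \<le> n" using assms by (cases p) auto
  have "path_connectedin (nsphere n) (topspace (nsphere n) \<inter> {x. 0 \<le> x n} \<union> topspace (nsphere n) \<inter> {x. x n \<le> 0})"
  proof (rule path_connectedin_Un)
    show "path_connectedin (nsphere n) (topspace (nsphere n) \<inter> {x. 0 \<le> x n})"
      using contractible_imp_path_connected_space[OF contractible_space_upper_hemisphere[of n n]]
      by (metis order_refl path_connectedin_def inf_le1 subtopology_restrict)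
    show "path_connectedin (nsphere n) (topspace (nsphere n) \<inter> {x. x n \<le> 0})"
      using contractible_imp_path_connected_space[OF contractible_space_lower_hemisphere[of n n]]
      by (metis order_refl path_connectedin_def inf_le1 subtopology_restrict)
    \<comment> \<open>The two closed hemispheres meet in the first basis vector, which lies on the
      equator because \<open>n\<close> is at least 1.\<close>
    have "(\<lambda>i. if i = 0 then 1 else 0) \<in> topspace (nsphere n)"
      by (simp add: nsphere if_distrib[of "\<lambda>x. x\<^sup>2"] cong: if_cong)
    then show "topspace (nsphere n) \<inter> {x. 0 \<le> x n} \<inter> (topspace (nsphere n) \<inter> {x. x n \<le> 0}) \<noteq> {}"
      using n(2) by force
  qed
  moreover have "topspace (nsphere n) \<inter> {x. 0 \<le> x n} \<union> topspace (nsphere n) \<inter> {x. x n \<le> 0} = topspace (nsphere n)"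
    by auto
  ultimately have "path_connected_space (nsphere n)" by (simp add: path_connectedin_topspace)
  moreover have "nsphere n = top_of_set (Bdry p)"
    using Bdry_subset_Disc[of p] unfolding n(1)
    by (simp flip: subtopology_disc_boundary add: disc_eq disc_boundary_eq subtopology_subtopology Int_absorb1)
  ultimately show ?thesis by (simp add: path_connected_space_def path_connected_def pathin_def path_def
        path_image_def pathstart_def pathfinish_def image_subset_iff_funcset)
qed

text \<open>Polar coordinates: the open annulus is the image of an interval of radii times the
  sphere. It becomes the overlap of collar and open cell.\<close>

lemma path_connected_annulus:
  assumes "2 \<le> p" shows "path_connected {v \<in> Disc p - Bdry p. sumsq p v > 1/4}"
proof -
  let ?f = "\<lambda>z :: real \<times> (nat \<Rightarrow> real). \<lambda>i. fst z * snd z i"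
  have "path_connected ({1/2<..<1::real} \<times> Bdry p)"
    by (intro path_connected_Times path_connected_Bdry assms convex_imp_path_connected) auto
  moreover have "continuous_on ({1/2<..<1::real} \<times> Bdry p) ?f"
    by (intro continuous_on_coordinatewise_then_product continuous_on_mult continuous_on_fst continuous_on_id)
       (rule continuous_on_app, intro continuous_intros)
  ultimately have "path_connected (?f ` ({1/2<..<1::real} \<times> Bdry p))"
    using path_connected_continuous_image by blast
  also have "?f ` ({1/2<..<1::real} \<times> Bdry p) = {v \<in> Disc p - Bdry p. sumsq p v > 1/4}"
  proof (intro equalityI subsetI)
    fix v assume "v \<in> ?f ` ({1/2<..<1::real} \<times> Bdry p)"
    then obtain r u where ru: "1/2 < r" "r < 1" "u \<in> Bdry p" "v = (\<lambda>i. r * u i)" by auto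
    have s: "sumsq p v = r\<^sup>2" using ru by (simp add: sumsq_scale Bdry_def)
    have "(1/2)\<^sup>2 < r\<^sup>2" using ru by (intro power_strict_mono) auto
    moreover have "r\<^sup>2 < 1" using ru by (simp add: power_less_one_iff)
    ultimately show "v \<in> {v \<in> Disc p - Bdry p. sumsq p v > 1/4}"
      using ru s by (auto simp: Disc_def Bdry_def power2_eq_square)
  next
    fix v assume v: "v \<in> {v \<in> Disc p - Bdry p. sumsq p v > 1/4}"
    define r where "r = sqrt (sumsq p v)"
    have "sqrt (1/4) < r" "r < 1" unfolding r_def
      using v sumsq_Disc_Bdry[of v p] by (simp_all only: real_sqrt_less_iff real_sqrt_lt_1_iff) auto
    then have r: "1/2 < r" "r < 1" by (simp_all add: real_sqrt_divide)
    have "r\<^sup>2 = sumsq p v" by (simp add: r_def)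
    moreover from this have "sumsq p v \<noteq> 0" using r by auto
    ultimately have "sumsq p (\<lambda>i. (1/r) * v i) = 1" using r by (simp only: sumsq_scale) (simp add: power_divide)
    then have "(\<lambda>i. (1/r) * v i) \<in> Bdry p" using v by (auto simp: Bdry_def Disc_def)
    then show "v \<in> ?f ` ({1/2<..<1::real} \<times> Bdry p)"
      using r by (intro image_eqI[of _ _ "(r, \<lambda>i. (1/r) * v i)"]) auto
  qed
  finally show ?thesis .
qed

lemma contractible_open_disc: "contractible (Disc p - Bdry p)"
  unfolding contractible_def
proof (intro exI)
  let ?h = "\<lambda>(t::real) (v::nat \<Rightarrow> real) i. (1 - t) * v i"
  let ?O = "Disc p - Bdry p"
  have "homotopic_with (\<lambda>k. k \<in> {} \<rightarrow> {}) (top_of_set ?O) (top_of_set ?O) id (\<lambda>x i. 0)"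
  proof (rule homotopic_with_top_of_setI[of _ ?h])
    show "continuous_on ({0..1} \<times> ?O) (\<lambda>z. ?h (fst z) (snd z))"
      by (intro continuous_on_coordinatewise_then_product continuous_on_mult continuous_on_diff
          continuous_on_const continuous_on_fst continuous_on_id)
         (rule continuous_on_app, intro continuous_intros)
    show "?h t v \<in> ?O" if "0 \<le> t" "t \<le> 1" "v \<in> ?O" for t v
    proof -
      have "(1 - t)\<^sup>2 * sumsq p v \<le> 1 * sumsq p v"
        using that by (intro mult_right_mono power_le_one) auto
      then have "sumsq p (?h t v) < 1" using sumsq_Disc_Bdry[OF that(3)] by (simp add: sumsq_scale)
      then show ?thesis using that by (auto simp: Disc_def Bdry_def)
    qed
  qed auto
  then show "homotopic_with_canon (\<lambda>x. True) ?O ?O id (\<lambda>x. \<lambda>i. 0)"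
    by (rule homotopic_with_mono) auto
qed

lemma (in cell_attachment) homotopic_loops_push:
  assumes q: "path q" "path_image q \<subseteq> collar" "pathfinish q = pathstart q"
  shows "homotopic_loops collar q (push 1 \<circ> q)"
  unfolding homotopic_loops
proof (intro exI conjI ballI)
  let ?h = "\<lambda>z. push (fst z) (q (snd z))"
  have qi: "q s \<in> collar" if "s \<in> {0..1}" for s using q that by (auto simp: path_image_def)
  show "continuous_on ({0..1} \<times> {0..1}) ?h"
  proof (rule continuous_on_compose2[OF continuous_on_push, of _ "\<lambda>z. (fst z, q (snd z))", simplified])
    have "continuous_on {0..1} q" using q by (simp add: path_def)
    then show "continuous_on ({0..1} \<times> {0..1}) (\<lambda>z. (fst z, q (snd z)))"
      by (intro continuous_intros) (auto elim!: continuous_on_compose2 intro: continuous_intros)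
    show "(\<lambda>z. (fst z, q (snd z))) ` ({0..1} \<times> {0..1}) \<subseteq> {0..1} \<times> X"
      using qi A_subset by auto
  qed
  show "?h \<in> {0..1} \<times> {0..1} \<rightarrow> collar" using qi push_collar by auto
  show "?h (0, s) = q s" if "s \<in> {0..1}" for s using qi[OF that] A_subset push_0 by auto
qed (use q in \<open>auto simp: pathfinish_def pathstart_def\<close>)

text \<open>The two open sets are the collar, whose loops \<open>push\<close> deforms into
  \<open>A\<close>, and the open cell, which is contractible. Their overlap is an annulus, path
  connected because \<open>p\<close> is at least 2.\<close>

lemma simply_connected_attach:
  fixes X A :: "'a::real_normed_vector set"
  assumes "cell_attachment X A p \<Phi>" and p: "2 \<le> p" and A: "simply_connected A" "A \<noteq> {}"
  shows "simply_connected X"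
proof -
  interpret cell_attachment X A p \<Phi> by fact
  have XU: "collar \<union> (X - A) = X" using A_subset by auto
  have im: "\<Phi> ` (Disc p - Bdry p) = X - A" using bdry disj by (auto simp: X_eq)
  have "simply_connected (collar \<union> (X - A))"
  proof (rule simply_connected_Un_open)
    show "openin (top_of_set (collar \<union> (X - A))) collar" unfolding XU by (rule openin_collar)
    show "openin (top_of_set (collar \<union> (X - A))) (X - A)"
      unfolding XU using closed_A by (metis Diff_eq openin_open_Int open_Compl)
    obtain a where a: "a \<in> A" using A by auto
    show "simply_connected collar"
      unfolding simply_connected_eq_contractible_loop_all
    proof (intro disjI2 bexI[of _ a] allI impI)
      fix q assume q: "path q \<and> path_image q \<subseteq> collar \<and> pathfinish q = pathstart q"
      let ?r = "push 1 \<circ> q"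
      have 1: "homotopic_loops collar q ?r" using q by (intro homotopic_loops_push) auto
      then have r: "path ?r" "pathfinish ?r = pathstart ?r"
        using homotopic_loops_imp_path homotopic_loops_imp_loop by blast+
      have "path_image ?r \<subseteq> A" using q push_1_collar by (auto simp: path_image_def)
      then have "homotopic_loops A ?r (linepath a a)"
        using A(1) r a unfolding simply_connected_def by auto
      then have "homotopic_loops collar ?r (linepath a a)"
        using A_subset homotopic_loops_subset by blast
      with 1 show "homotopic_loops collar q (linepath a a)" by (metis homotopic_loops_trans)
    qed (use a A_subset in auto)
    have "top_of_set (Disc p - Bdry p) homeomorphic_space top_of_set (X - A)"
      using homeomorphic_cell homeomorphic_map_imp_homeomorphic_space by blast
    then have "contractible (X - A)"
      using homeomorphic_space_contractibility contractible_open_disc by (metis contractible_space_top_of_set)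
    then show "simply_connected (X - A)" by (rule contractible_imp_simply_connected)
    have eq: "collar \<inter> (X - A) = \<Phi> ` {v \<in> Disc p - Bdry p. sumsq p v > 1/4}"
      using bdry disj A_subset by (auto simp: collar_def X_eq)
    show "path_connected (collar \<inter> (X - A))"
      unfolding eq using path_connected_annulus[OF p] continuous_on_subset[OF cont]
      by (intro path_connected_continuous_image) auto
    \<comment> \<open>Any radius strictly between 1/2 and 1 would do as a witness for the
      annulus.\<close>
    let ?v = "\<lambda>i. if i = 0 then 3/4 else (0::real)"
    obtain n where n: "p = Suc n" using p by (cases p) auto
    have "sumsq p ?v = 9/16"
      unfolding sumsq_def n sum.lessThan_Suc_shift by (simp add: power2_eq_square)
    then have "?v \<in> {v \<in> Disc p - Bdry p. sumsq p v > 1/4}" using p by (auto simp: Disc_def Bdry_def)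
    then show "collar \<inter> (X - A) \<noteq> {}" unfolding eq by blast
  qed
  then show ?thesis by (simp only: XU)
qed

text \<open>The library proves the group laws for paths up to homotopy only in normed spaces, so wedges are
  embedded into one.\<close>

definition unit_fun :: "nat \<Rightarrow> (nat, real) bcontfun" where
  "unit_fun m = Bcontfun (\<lambda>k. if k = m then 1 else 0)"

definition embed :: "nat set \<Rightarrow> (nat \<Rightarrow> real) \<Rightarrow> (nat, real) bcontfun" where
  "embed M x = (\<Sum>m\<in>M. x m *\<^sub>R unit_fun m)"

lemma apply_unit_fun: "apply_bcontfun (unit_fun m) k = (if k = m then 1 else 0)"
proof -
  have "(\<lambda>k. if k = m then 1 else 0 :: real) \<in> bcontfun"
    by (rule bcontfun_normI[of _ 1]) (auto simp: continuous_on_discrete)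
  then show ?thesis by (simp add: unit_fun_def Bcontfun_inverse)
qed

lemma apply_embed: "finite M \<Longrightarrow> apply_bcontfun (embed M x) k = (if k \<in> M then x k else 0)"
  unfolding embed_def by (induction M rule: finite_induct) (auto simp: apply_unit_fun)

lemma continuous_on_embed: "continuous_on S (embed M)"
  unfolding embed_def
  by (intro continuous_on_sum continuous_on_scaleR continuous_on_const) (rule continuous_on_app, rule continuous_on_id)

lemma inj_on_embed:
  assumes "finite M" "\<And>x m. x \<in> S \<Longrightarrow> m \<notin> M \<Longrightarrow> x m = 0"
  shows "inj_on (embed M) S"
proof (rule inj_onI)
  fix x y assume xy: "x \<in> S" "y \<in> S" "embed M x = embed M y"
  have "x m = y m" for m
  proof (cases "m \<in> M")
    case True
    then show ?thesis
      using arg_cong[OF xy(3), of "\<lambda>f. apply_bcontfun f m"] by (simp add: apply_embed assms(1))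
  next
    case False
    then show ?thesis using assms(2)[OF xy(1)] assms(2)[OF xy(2)] by simp
  qed
  then show "x = y" by (simp add: fun_eq_iff)
qed

definition coords :: "cell set \<Rightarrow> nat set" where
  "coords C = (\<Union>c\<in>C. blk c ` {..fst c})"

lemma wedge_coords:
  assumes "x \<in> wedge C" "m \<notin> coords C" shows "x m = 0"
  using assms(1)
proof (cases rule: wedge_cases)
  case (2 c v)
  have "m \<noteq> blk c j" if "j \<le> fst c" for j using assms(2) 2(1) that by (auto simp: coords_def)
  then have "cell_of m \<noteq> c \<or> fst c < slot_of m" by (metis blk_cell_slot not_le)
  then show ?thesis using 2 by (auto simp: cell_map_def)
qed simp

text \<open>Cells are attached one at a time. The embedding is fixed by the full set
  \<open>C\<close> while \<open>D\<close> grows, so the images of successive wedges are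
  nested.\<close>

lemma simply_connected_embed_wedge:
  assumes "finite C" "D \<subseteq> C" "\<And>c. c \<in> D \<Longrightarrow> 2 \<le> fst c"
  shows "simply_connected (embed (coords C) ` wedge D)"
proof -
  have "finite D" using assms finite_subset by blast
  let ?E = "embed (coords C)"
  have fin: "finite (coords C)" using assms(1) by (simp add: coords_def)
  have inj: "inj_on ?E (wedge C)" using wedge_coords by (intro inj_on_embed fin)
  show ?thesis
    using \<open>finite D\<close> assms(2,3)
  proof (induction D rule: finite_induct)
    case empty
    have "simply_connected {?E origin}" by (rule convex_imp_simply_connected) simp
    then show ?case by simp
  next
    case (insert c D)
    interpret A: cell_attachment "wedge (insert c D)" "wedge D" "fst c" "cell_map c"
      using insert by (intro cell_attachment_wedge) auto
    have inj': "inj_on ?E (wedge (insert c D))"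
      using inj wedge_mono[OF insert.prems(1)] inj_on_subset by blast
    have im: "cell_map c ` (Disc (fst c) - Bdry (fst c)) \<subseteq> wedge (insert c D)"
      using A.X_eq by auto
    have "cell_attachment (?E ` wedge (insert c D)) (?E ` wedge D) (fst c) (?E \<circ> cell_map c)"
    proof
      show "continuous_on (Disc (fst c)) (?E \<circ> cell_map c)"
        using continuous_on_compose[OF A.cont continuous_on_embed] .
      show "?E ` wedge (insert c D) = ?E ` wedge D \<union> (?E \<circ> cell_map c) ` Disc (fst c)"
        using A.X_eq by (simp add: image_Un image_comp)
      show "closed (?E ` wedge D)"
        using insert by (intro compact_imp_closed compact_continuous_image continuous_on_embed compact_wedge) auto
      show "(?E \<circ> cell_map c) ` Bdry (fst c) \<subseteq> ?E ` wedge D" using A.bdry by auto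
      show "inj_on (?E \<circ> cell_map c) (Disc (fst c) - Bdry (fst c))"
        by (rule comp_inj_on[OF A.inj inj_on_subset[OF inj' im]])
      have "?E ` (cell_map c ` (Disc (fst c) - Bdry (fst c)) \<inter> wedge D)
          = ?E ` cell_map c ` (Disc (fst c) - Bdry (fst c)) \<inter> ?E ` wedge D"
        using inj' im A.A_subset by (intro inj_on_image_Int) auto
      then show "(?E \<circ> cell_map c) ` (Disc (fst c) - Bdry (fst c)) \<inter> ?E ` wedge D = {}"
        using A.disj by (simp add: image_comp)
    qed
    moreover have "2 \<le> fst c" using insert.prems(2) by simp
    moreover have "simply_connected (?E ` wedge D)" using insert.IH insert.prems by simp
    moreover have "?E ` wedge D \<noteq> {}" using origin_in_wedge by blast
    ultimately show ?case by (rule simply_connected_attach)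
  qed
qed

text \<open>A loop in \<open>S\<close> is contracted after applying \<open>f\<close>, and
  \<open>g\<close> carries the contraction back. This also passes from the type-class notion to
  \<open>simply_connected_space\<close>.\<close>

lemma simply_connected_space_homeomorphism:
  fixes S :: "'a::topological_space set" and T :: "'b::real_normed_vector set"
  assumes hom: "homeomorphism S T f g" and T: "simply_connected T" and ne: "S \<noteq> {}"
  shows "simply_connected_space (top_of_set S)"
  unfolding simply_connected_space_def
proof (intro conjI ballI allI impI)
  have f: "continuous_on S f" "f ` S = T" and g: "continuous_on T g" "g ` T = S"
    and gf: "\<And>x. x \<in> S \<Longrightarrow> g (f x) = x"
    using hom by (auto simp: homeomorphism_def)
  show "topspace (top_of_set S) \<noteq> {}" using ne by simp
  have "path_connected (g ` T)"
    using T g by (intro path_connected_continuous_image simply_connected_imp_path_connected)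
  then show "path_connected_space (top_of_set S)"
    by (simp add: g path_connected_space_def path_connected_def pathin_def path_def
        path_image_def pathstart_def pathfinish_def image_subset_iff_funcset)
  fix x c assume x: "x \<in> topspace (top_of_set S)" and c: "pathin (top_of_set S) c \<and> c 0 = x \<and> c 1 = x"
  have c': "continuous_on {0..1} c" "c ` {0..1} \<subseteq> S" using c by (auto simp: pathin_def)
  have "homotopic_paths T (f \<circ> c) (linepath (f x) (f x))"
  proof -
    have "path (f \<circ> c)" unfolding path_def
      using continuous_on_compose[OF c'(1) continuous_on_subset[OF f(1) c'(2)]] .
    moreover have "path_image (f \<circ> c) \<subseteq> T" using c' f by (auto simp: path_image_def)
    moreover have "pathstart (f \<circ> c) = f x" "pathfinish (f \<circ> c) = f x"
      using c by (auto simp: pathstart_def pathfinish_def)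
    ultimately show ?thesis using T unfolding simply_connected_eq_contractible_path by metis
  qed
  then obtain h where h: "continuous_on ({0..1::real} \<times> {0..1::real}) h" "h \<in> {0..1} \<times> {0..1} \<rightarrow> T"
    "\<And>s. s \<in> {0..1} \<Longrightarrow> h (0, s) = f (c s)" "\<And>s. s \<in> {0..1} \<Longrightarrow> h (1, s) = f x"
    "\<And>t. t \<in> {0..1} \<Longrightarrow> h (t, 0) = f x \<and> h (t, 1) = f x"
    using c unfolding homotopic_paths by (auto simp: pathstart_def pathfinish_def linepath_def algebra_simps
        simp flip: scaleR_add_left)
  show "homotopic_with (\<lambda>d. d 0 = x \<and> d 1 = x) (top_of_set {0..1}) (top_of_set S) c (\<lambda>t. x)"
  proof (subst homotopic_with)
    show "\<exists>k. continuous_map (prod_topology (top_of_set {0..1::real}) (top_of_set {0..1})) (top_of_set S) k \<and>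
        (\<forall>s\<in>topspace (top_of_set {0..1}). k (0, s) = c s) \<and>
        (\<forall>s\<in>topspace (top_of_set {0..1}). k (1, s) = x) \<and> (\<forall>t\<in>{0..1}. k (t, 0) = x \<and> k (t, 1) = x)"
    proof (intro exI conjI ballI)
      have "continuous_on ({0..1} \<times> {0..1}) (g \<circ> h)"
        using h by (intro continuous_on_compose continuous_on_subset[OF g(1)]) auto
      moreover have "(g \<circ> h) ` ({0..1} \<times> {0..1}) \<subseteq> S" using h(2) g by auto
      ultimately show "continuous_map (prod_topology (top_of_set {0..1}) (top_of_set {0..1})) (top_of_set S) (g \<circ> h)"
        by (auto simp: o_def)
    qed (use h gf x c' in \<open>auto simp: image_subset_iff\<close>)
  qed auto
qed

lemma simply_connected_space_wedge:
  assumes "finite C" "\<And>c. c \<in> C \<Longrightarrow> 2 \<le> fst c"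
  shows "simply_connected_space (top_of_set (wedge C))"
proof -
  have fin: "finite (coords C)" using assms(1) by (simp add: coords_def)
  have "inj_on (embed (coords C)) (wedge C)" using wedge_coords by (intro inj_on_embed fin)
  then obtain g where g: "homeomorphism (wedge C) (embed (coords C) ` wedge C) (embed (coords C)) g"
    using homeomorphism_compact[OF compact_wedge[OF assms(1)] continuous_on_embed refl] by blast
  have "wedge C \<noteq> {}" using origin_in_wedge by blast
  with g simply_connected_embed_wedge[OF assms(1) order_refl assms(2)] show ?thesis
    by (rule simply_connected_space_homeomorphism)
qed

section \<open>The CW structure and its cellular chain maps\<close>

text \<open>The value \<open>n 0\<close> is ignored: there is always exactly one 0-cell.\<close>

definition cells :: "(nat \<Rightarrow> nat) \<Rightarrow> cell set" where
  "cells n = {c. 1 \<le> fst c \<and> snd c < n (fst c)}"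

definition wedge_cw :: "(nat \<Rightarrow> nat) \<Rightarrow> (nat \<Rightarrow> real) cw" where
  "wedge_cw n = \<lparr>cw_space = top_of_set (wedge (cells n)),
     num_cells = (\<lambda>p. if p = 0 then 1 else n p),
     char_map = (\<lambda>p i. if p = 0 then (\<lambda>v. origin) else cell_map (p, i))\<rparr>"

lemma wedge_cw_simps [simp]:
  "cw_space (wedge_cw n) = top_of_set (wedge (cells n))"
  "num_cells (wedge_cw n) 0 = 1"
  "1 \<le> p \<Longrightarrow> num_cells (wedge_cw n) p = n p"
  "char_map (wedge_cw n) 0 i = (\<lambda>v. origin)"
  "1 \<le> p \<Longrightarrow> char_map (wedge_cw n) p i = cell_map (p, i)"
  by (auto simp: wedge_cw_def)

definition skel :: "(nat \<Rightarrow> nat) \<Rightarrow> nat \<Rightarrow> cell set" where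
  "skel n p = {c \<in> cells n. fst c \<le> p}"

lemma finite_cells:
  assumes "finite {p. n p \<noteq> 0}" shows "finite (cells n)"
proof -
  have "cells n \<subseteq> (SIGMA p:{p. n p \<noteq> 0}. {..<n p})" by (auto simp: cells_def)
  then show ?thesis using assms by (meson finite_SigmaI finite_lessThan finite_subset)
qed

lemma wedge_open_cells:
  "wedge C = insert origin (\<Union>c\<in>C. cell_map c ` (Disc (fst c) - Bdry (fst c)))"
  by (auto elim!: wedge_cases intro: cell_map_Disc_in_wedge)

lemma Disc_0: "Disc 0 = {origin}" and Bdry_0: "Bdry 0 = {}"
  by (auto simp: Disc_def Bdry_def sumsq_def)

lemma open_cell_0: "open_cell (wedge_cw n) 0 i = {origin}"
  by (simp add: open_cell_def disc_interior_eq Disc_0 Bdry_0)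

lemma open_cell_pos: "1 \<le> p \<Longrightarrow> open_cell (wedge_cw n) p i = cell_map (p, i) ` (Disc p - Bdry p)"
  by (simp add: open_cell_def disc_interior_eq)

lemma skeleton_wedge: "skeleton (wedge_cw n) (int p) = wedge (skel n p)"
proof -
  have "(\<Union>q\<in>{q. int q \<le> int p}. \<Union>i<num_cells (wedge_cw n) q. open_cell (wedge_cw n) q i)
    = {origin} \<union> (\<Union>q\<in>{q. 1 \<le> q \<and> q \<le> p}. \<Union>i<n q. cell_map (q, i) ` (Disc q - Bdry q))"
    (is "?L = ?R")
  proof -
    have "{q. int q \<le> int p} = insert 0 {q. 1 \<le> q \<and> q \<le> p}" by auto
    then have "?L = open_cell (wedge_cw n) 0 0 \<union> (\<Union>q\<in>{q. 1 \<le> q \<and> q \<le> p}. \<Union>i<num_cells (wedge_cw n) q. open_cell (wedge_cw n) q i)"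
      by (simp add: lessThan_Suc)
    also have "\<dots> = ?R" using open_cell_0 open_cell_pos by (intro arg_cong2[of _ _ _ _ "(\<union>)"] SUP_cong) auto
    finally show ?thesis .
  qed
  also have "\<dots> = wedge (skel n p)"
    unfolding wedge_open_cells by (force simp: skel_def cells_def)
  finally show ?thesis by (simp add: skeleton_def)
qed

lemma skeleton_neg: "k < 0 \<Longrightarrow> skeleton X k = {}"
  by (auto simp: skeleton_def)

lemma finite_CW_complex_wedge:
  assumes n: "finite {p. n p \<noteq> 0}"
  shows "finite_CW_complex (wedge_cw n)"
  unfolding finite_CW_complex_def
proof (intro conjI allI impI)
  show "Hausdorff_space (cw_space (wedge_cw n))" by (simp add: Hausdorff_space_subtopology)
  have "{p. num_cells (wedge_cw n) p \<noteq> 0} \<subseteq> insert 0 {p. n p \<noteq> 0}" by (auto simp: wedge_cw_def)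
  then show "finite {p. num_cells (wedge_cw n) p \<noteq> 0}" using n finite_subset by blast
  have all: "(\<Union>p. \<Union>i<num_cells (wedge_cw n) p. open_cell (wedge_cw n) p i) = (\<Union>p. skeleton (wedge_cw n) (int p))"
    by (auto simp: skeleton_def)
  have "(\<Union>p. wedge (skel n p)) = wedge (cells n)"
    by (auto simp: wedge_def skel_def)
  then show "topspace (cw_space (wedge_cw n)) = (\<Union>p. \<Union>i<num_cells (wedge_cw n) p. open_cell (wedge_cw n) p i)"
    unfolding all skeleton_wedge by simp
next
  fix p i q j assume h: "i < num_cells (wedge_cw n) p \<and> j < num_cells (wedge_cw n) q \<and> (p, i) \<noteq> (q, j)"
  have ne: "cell_map (p, i) v \<noteq> origin" if "v \<in> Disc p - Bdry p" for p i v
    using sumsq_Disc_Bdry[OF that] by (simp add: cell_map_eq_origin)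
  then have no: "origin \<notin> cell_map (p, i) ` (Disc p - Bdry p)" for p i by (metis imageE)
  consider "p = 0" "q = 0" | "p = 0" "1 \<le> q" | "1 \<le> p" "q = 0" | "1 \<le> p" "1 \<le> q" by linarith
  then show "open_cell (wedge_cw n) p i \<inter> open_cell (wedge_cw n) q j = {}"
  proof cases
    case 1 then show ?thesis using h by auto
  next
    case 2 then show ?thesis using no by (simp add: open_cell_0 open_cell_pos)
  next
    case 3 then show ?thesis using no by (simp add: open_cell_0 open_cell_pos)
  next
    case 4
    have "cell_map (p, i) v \<noteq> cell_map (q, j) w" if "v \<in> Disc p - Bdry p" for v w
      using cell_map_disjoint[of "(p, i)" v "(q, j)" w] ne[OF that, of i] h by auto
    then show ?thesis using 4 by (auto simp: open_cell_pos)
  qed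
next
  fix p i assume i: "i < num_cells (wedge_cw n) p"
  show "continuous_map (disc p) (cw_space (wedge_cw n)) (char_map (wedge_cw n) p i)"
  proof (cases p)
    case 0 then show ?thesis by simp
  next
    case (Suc k)
    then have "(p, i) \<in> cells n" using i by (simp add: cells_def)
    then show ?thesis
      using Suc continuous_on_cell_map[OF continuous_on_id] cell_map_Disc_in_wedge[of "(p, i)"]
      by (auto simp: disc_eq)
  qed
  show "char_map (wedge_cw n) p i ` disc_boundary p \<subseteq> skeleton (wedge_cw n) (int p - 1)"
  proof (cases p)
    case 0 then show ?thesis by (simp add: disc_boundary_eq Bdry_0)
  next
    case (Suc k)
    then have "skeleton (wedge_cw n) (int p - 1) = wedge (skel n k)" using skeleton_wedge[of n k] by simp
    then show ?thesis using Suc cell_map_Bdry[of _ "(p, i)"] by (auto simp: disc_boundary_eq)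
  qed
  show "homeomorphic_map (subtopology (disc p) (disc_interior p))
      (subtopology (cw_space (wedge_cw n)) (open_cell (wedge_cw n) p i)) (char_map (wedge_cw n) p i)"
  proof (cases p)
    case 0
    have "subtopology (disc p) (disc_interior p) = top_of_set {origin}"
      using 0 by (simp add: disc_eq disc_interior_eq Disc_0 Bdry_0 subtopology_subtopology)
    moreover have "subtopology (cw_space (wedge_cw n)) (open_cell (wedge_cw n) p i) = top_of_set {origin}"
      using 0 by (simp add: open_cell_0 subtopology_subtopology)
    ultimately show ?thesis
      using 0 by (auto simp: homeomorphic_map_maps homeomorphic_maps_def intro!: exI[of _ "\<lambda>_. origin"])
  next
    case (Suc k)
    \<comment> \<open>An open cell has the same subspace topology inside the wedge of this one cell,
      where it is the complement of the tip.\<close>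
    interpret S: cell_attachment "wedge {(p, i)}" "{origin}" p "cell_map (p, i)"
      using cell_attachment_wedge[of "{}" "(p, i)"] by simp
    have c: "(p, i) \<in> cells n" using i Suc by (simp add: cells_def)
    have im: "cell_map (p, i) ` (Disc p - Bdry p) = wedge {(p, i)} - {origin}"
      using S.homeomorphic_cell homeomorphic_imp_surjective_map by fastforce
    have "wedge {(p, i)} - {origin} \<subseteq> wedge (cells n)" using wedge_mono[of "{(p, i)}" "cells n"] c by auto
    then have "wedge (cells n) \<inter> (wedge {(p, i)} - {origin}) = wedge {(p, i)} - {origin}" by auto
    moreover have "open_cell (wedge_cw n) p i = wedge {(p, i)} - {origin}"
      using Suc open_cell_pos[of p n i] im by simp
    ultimately have "subtopology (cw_space (wedge_cw n)) (open_cell (wedge_cw n) p i) = top_of_set (wedge {(p, i)} - {origin})"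
      by (simp add: subtopology_subtopology)
    moreover have "subtopology (disc p) (disc_interior p) = top_of_set (Disc p - Bdry p)"
    proof -
      have "Disc p \<inter> (Disc p - Bdry p) = Disc p - Bdry p" by auto
      then show ?thesis by (simp add: disc_eq disc_interior_eq subtopology_subtopology)
    qed
    ultimately show ?thesis using S.homeomorphic_cell Suc by simp
  qed
qed

lemma hom_finprod_comm_group:
  assumes "comm_group G" "comm_group H" "h \<in> hom G H" "f \<in> A \<rightarrow> carrier G"
  shows "h (finprod G f A) = finprod H (\<lambda>x. h (f x)) A"
proof -
  interpret G: comm_group G by fact
  interpret H: comm_group H by fact
  interpret h: group_hom G H h
    using assms(3) by (intro group_homI) (simp_all add: G.is_group H.is_group)
  show ?thesis
    using assms(4)
  proof (induction A rule: infinite_finite_induct)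
    case (insert x A)
    then have "f \<in> A \<rightarrow> carrier G" "f x \<in> carrier G" "(\<lambda>x. h (f x)) \<in> A \<rightarrow> carrier H"
      by (auto simp: Pi_iff)
    then show ?case using insert by (simp add: G.finprod_closed)
  qed auto
qed

lemma finprod_in_subgroup:
  assumes "comm_group G" "subgroup K G" "f \<in> A \<rightarrow> K"
  shows "finprod G f A \<in> K"
proof -
  interpret G: comm_group G by fact
  show ?thesis
    using assms(3)
  proof (induction A rule: infinite_finite_induct)
    case (insert x A)
    then have "f \<in> A \<rightarrow> carrier G" "f x \<in> carrier G"
      using subgroup.mem_carrier[OF assms(2)] by auto
    then show ?case using insert by (simp add: subgroup.m_closed[OF assms(2)])
  qed (auto simp: subgroup.one_closed[OF assms(2)])
qed

section \<open>Chain groups and chain maps of a wedge of spheres\<close>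

locale sphere_wedge =
  fixes n :: "nat \<Rightarrow> nat"
  assumes finite_dims: "finite {p. n p \<noteq> 0}"
begin

abbreviation "X \<equiv> wedge_cw n"
abbreviation "Z p \<equiv> wedge (skel n p)"
text \<open>The subtraction is on natural numbers, so this is the lower skeleton only for
  \<open>1 \<le> p\<close>; degree 0, where the lower skeleton is empty, is treated apart in
  \<open>cell_matrix_0\<close>.\<close>

abbreviation "L p \<equiv> wedge (skel n (p - 1))"
abbreviation "gen p i \<equiv> cell_generator X p i"
abbreviation "cellchains p \<equiv> cell_chain_group X p"

lemma skel_subset: "skel n p \<subseteq> cells n"
  by (auto simp: skel_def)

lemma Z_subset: "Z p \<subseteq> wedge (cells n)"
  using wedge_mono skel_subset by blast

lemma subtopology_skeleton: "subtopology (cw_space X) (skeleton X (int p)) = top_of_set (Z p)"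
  using Z_subset by (simp add: skeleton_wedge subtopology_subtopology Int_absorb1)

lemma low_skeleton: "1 \<le> p \<Longrightarrow> skeleton X (int p - 1) = L p"
  using skeleton_wedge[of n "p - 1"] by (simp add: of_nat_diff)

lemma cellchains_eq: "1 \<le> p \<Longrightarrow> cellchains p = relative_homology_group (int p) (top_of_set (Z p)) (L p)"
  by (simp only: cell_chain_group_def subtopology_skeleton low_skeleton)

lemma gen_eq: "1 \<le> p \<Longrightarrow> gen p i = hom_induced (int p) (top_of_set (Disc p)) (Bdry p)
    (top_of_set (Z p)) (L p) (cell_map (p, i)) (disc_generator p)"
  by (simp only: cell_generator_def subtopology_skeleton low_skeleton wedge_cw_simps(5) disc_eq disc_boundary_eq)

lemma chain_map_eq: "1 \<le> p \<Longrightarrow> cell_chain_map X p g =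
    hom_induced (int p) (top_of_set (Z p)) (L p) (top_of_set (Z p)) (L p) g"
  by (simp only: cell_chain_map_def subtopology_skeleton low_skeleton)

lemma comm_group_cellchains: "1 \<le> p \<Longrightarrow> comm_group (cellchains p)"
  by (simp add: cellchains_eq)

lemma gen_carrier: "1 \<le> p \<Longrightarrow> gen p i \<in> carrier (cellchains p)"
  by (simp add: cellchains_eq gen_eq hom_induced_carrier)

lemma cell_in_skel: "1 \<le> p \<Longrightarrow> i < n p \<Longrightarrow> (p, i) \<in> skel n p"
  by (simp add: skel_def cells_def)

lemma continuous_map_cell:
  "1 \<le> p \<Longrightarrow> i < n p \<Longrightarrow> continuous_map (top_of_set (Disc p)) (top_of_set (Z p)) (cell_map (p, i))"
  using continuous_on_cell_map[OF continuous_on_id] cell_map_Disc_in_wedge[OF cell_in_skel] by auto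

lemma cell_map_Bdry_origin: "cell_map (p, i) \<in> Bdry p \<rightarrow> {origin}"
  using cell_map_Bdry[of _ "(p, i)"] by auto

lemma cell_map_Bdry_wedge: "cell_map (p, i) \<in> Bdry p \<rightarrow> wedge C"
  using cell_map_Bdry[of _ "(p, i)"] by auto

text \<open>Collapsing the skeleton to the i-th sphere kills all generators but the i-th, whose
  image has infinite order by \<open>iso_cell\<close>. Equal combinations therefore have equal i-th
  coefficients.\<close>

lemma generators_independent:
  fixes k l :: "nat \<Rightarrow> int"
  assumes p: "1 \<le> p" and i: "i < n p"
    and eq: "finprod (cellchains p) (\<lambda>j. gen p j [^]\<^bsub>cellchains p\<^esub> k j) {..<n p}
      = finprod (cellchains p) (\<lambda>j. gen p j [^]\<^bsub>cellchains p\<^esub> l j) {..<n p}"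
  shows "k i = l i"
proof -
  let ?D = "top_of_set (Disc p)"
  let ?T = "top_of_set (wedge {(p, i)})"
  let ?K = "relative_homology_group (int p) ?T {origin}"
  let ?h = "hom_induced (int p) (top_of_set (Z p)) (L p) ?T {origin} (keep {(p, i)})"
  let ?\<Phi> = "hom_induced (int p) ?D (Bdry p) ?T {origin} (cell_map (p, i))"
  let ?G = "relative_homology_group (int p) ?D (Bdry p)"
  define t where "t = ?\<Phi> (disc_generator p)"
  interpret G: comm_group "cellchains p" by (rule comm_group_cellchains[OF p])
  interpret K: comm_group ?K by simp
  interpret S: cell_attachment "wedge {(p, i)}" "{origin}" p "cell_map (p, i)"
    using cell_attachment_wedge[of "{}" "(p, i)"] by simp
  interpret h: group_hom "cellchains p" ?K ?h
    using p by (intro group_homI) (auto simp: cellchains_eq hom_induced_hom)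
  interpret \<Phi>: group_hom ?G ?K ?\<Phi>
    by (intro group_homI) (auto simp: hom_induced_hom)
  have t: "t \<in> carrier ?K" by (simp add: t_def hom_induced_carrier)
  have kc: "continuous_map (top_of_set (Z p)) ?T (keep {(p, i)})"
    using continuous_on_keep keep_wedge[of _ "skel n p" "{(p, i)}"] cell_in_skel[OF p i] by auto
  \<comment> \<open>Cells of the lower skeleton have dimension at most \<open>p - 1\<close>, so none
    of them is kept.\<close>
  have kL: "keep {(p, i)} \<in> L p \<rightarrow> {origin}"
  proof -
    have "skel n (p - 1) \<inter> {(p, i)} = {}" using p by (auto simp: skel_def)
    then show ?thesis using keep_wedge[of _ "skel n (p - 1)" "{(p, i)}"] by auto
  qed
  have hg: "?h (gen p j) = (if j = i then t else \<one>\<^bsub>?K\<^esub>)" if j: "j < n p" for j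
  proof -
    have "?h (gen p j) = hom_induced (int p) ?D (Bdry p) ?T {origin} (keep {(p, i)} \<circ> cell_map (p, j)) (disc_generator p)"
      unfolding gen_eq[OF p]
      by (rule hom_induced_compose'[OF continuous_map_cell[OF p j] cell_map_Bdry_wedge kc kL])
    also have "\<dots> = (if j = i then t else \<one>\<^bsub>?K\<^esub>)"
    proof (cases "j = i")
      case True
      then show ?thesis unfolding t_def
        by simp (rule fun_cong, rule hom_induced_eq, simp add: keep_cell_map)
    next
      case False
      have "hom_induced (int p) ?D (Bdry p) ?T {origin} (keep {(p, i)} \<circ> cell_map (p, j)) (disc_generator p) = \<one>\<^bsub>?K\<^esub>"
      proof (rule hom_induced_into_subspace)
        show "continuous_map ?D ?T (keep {(p, i)} \<circ> cell_map (p, j))"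
          by (rule continuous_map_compose[OF continuous_map_cell[OF p j] kc])
        show "(keep {(p, i)} \<circ> cell_map (p, j)) ` topspace ?D \<subseteq> {origin}"
          using False by (auto simp: keep_cell_map)
      qed
      then show ?thesis using False by simp
    qed
    finally show ?thesis .
  qed
  have hf: "?h (finprod (cellchains p) (\<lambda>j. gen p j [^]\<^bsub>cellchains p\<^esub> m j) {..<n p}) = ?\<Phi> (disc_generator p [^]\<^bsub>?G\<^esub> m i)"
    for m :: "nat \<Rightarrow> int"
  proof -
    have "?h (finprod (cellchains p) (\<lambda>j. gen p j [^]\<^bsub>cellchains p\<^esub> m j) {..<n p})
      = finprod ?K (\<lambda>j. ?h (gen p j [^]\<^bsub>cellchains p\<^esub> m j)) {..<n p}"
      by (rule hom_finprod_comm_group[OF G.comm_group_axioms K.comm_group_axioms h.homh])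
         (use gen_carrier[OF p] in auto)
    also have "\<dots> = finprod ?K (\<lambda>j. if i = j then t [^]\<^bsub>?K\<^esub> m j else \<one>\<^bsub>?K\<^esub>) {..<n p}"
    proof (rule K.finprod_cong')
      fix j assume "j \<in> {..<n p}"
      then have "?h (gen p j [^]\<^bsub>cellchains p\<^esub> m j) = (if j = i then t else \<one>\<^bsub>?K\<^esub>) [^]\<^bsub>?K\<^esub> m j"
        using h.hom_int_pow[OF gen_carrier[OF p]] hg by (simp del: one_relative_homology_group)
      then show "?h (gen p j [^]\<^bsub>cellchains p\<^esub> m j) = (if i = j then t [^]\<^bsub>?K\<^esub> m j else \<one>\<^bsub>?K\<^esub>)"
        using K.int_pow_one by (simp del: one_relative_homology_group)
    qed (use t K.one_closed in \<open>auto simp del: one_relative_homology_group\<close>)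
    also have "\<dots> = t [^]\<^bsub>?K\<^esub> m i"
      using i t by (intro K.finprod_singleton) auto
    also have "\<dots> = ?\<Phi> (disc_generator p [^]\<^bsub>?G\<^esub> m i)"
      using \<Phi>.hom_int_pow[of "disc_generator p" "m i"] disc_generator_carrier[of p]
      by (simp add: t_def disc_eq disc_boundary_eq)
    finally show ?thesis .
  qed
  have "inj_on ?\<Phi> (carrier ?G)" using S.iso_cell[of "int p"] by (auto simp: iso_def bij_betw_def)
  moreover have "?\<Phi> (disc_generator p [^]\<^bsub>?G\<^esub> k i) = ?\<Phi> (disc_generator p [^]\<^bsub>?G\<^esub> l i)"
    unfolding hf[symmetric] by (simp only: eq)
  moreover have "disc_generator p [^]\<^bsub>?G\<^esub> m \<in> carrier ?G" for m :: int
    using disc_generator_carrier[of p] by (intro \<Phi>.G.int_pow_closed) (simp add: disc_eq disc_boundary_eq)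
  ultimately have "disc_generator p [^]\<^bsub>?G\<^esub> k i = disc_generator p [^]\<^bsub>?G\<^esub> l i"
    by (meson inj_onD)
  then show ?thesis using disc_generator_pow_inject[of p "k i" "l i"] by (simp add: disc_eq disc_boundary_eq)
qed

lemma cellular_map_iff:
  "cellular_map X g \<longleftrightarrow> continuous_on (wedge (cells n)) g \<and> g ` wedge (cells n) \<subseteq> wedge (cells n) \<and> (\<forall>p. g ` Z p \<subseteq> Z p)"
proof -
  have "(\<forall>k. g ` skeleton X k \<subseteq> skeleton X k) \<longleftrightarrow> (\<forall>p. g ` Z p \<subseteq> Z p)"
  proof
    assume r: "\<forall>p. g ` Z p \<subseteq> Z p"
    show "\<forall>k. g ` skeleton X k \<subseteq> skeleton X k"
    proof
      fix k show "g ` skeleton X k \<subseteq> skeleton X k"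
      proof (cases "k < 0")
        case True then show ?thesis by (simp add: skeleton_neg)
      next
        case False
        then have "skeleton X k = Z (nat k)" using skeleton_wedge[of n "nat k"] by simp
        then show ?thesis using r by simp
      qed
    qed
  qed (metis skeleton_wedge)
  then show ?thesis by (auto simp: cellular_map_def image_subset_iff_funcset)
qed

text \<open>The prescribed combination of generators is realizable by a disc map for each cell. All
  these maps send the boundary to the tip, so they fit together; each has values in the skeleton of
  its own dimension, which makes the result cellular.\<close>

lemma cellular_map_realization:
  fixes A :: "nat \<Rightarrow> nat \<Rightarrow> nat \<Rightarrow> int"
  obtains f where "cellular_map X f"
    and "\<And>p j. 1 \<le> p \<Longrightarrow> j < n p \<Longrightarrow> cell_chain_map X p f (gen p j) =
      finprod (cellchains p) (\<lambda>i. gen p i [^]\<^bsub>cellchains p\<^esub> A p i j) {..<n p}"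
proof -
  let ?I = "\<lambda>p. hom_induced (int p) (disc p) (disc_boundary p) (top_of_set (Z p)) (L p)"
  let ?t = "\<lambda>p j. finprod (cellchains p) (\<lambda>i. gen p i [^]\<^bsub>cellchains p\<^esub> A p i j) {..<n p}"
  have "\<exists>\<phi>. continuous_on (Disc (fst c)) \<phi> \<and> \<phi> ` Disc (fst c) \<subseteq> Z (fst c) \<and> \<phi> ` Bdry (fst c) \<subseteq> {origin} \<and>
      ?I (fst c) \<phi> (disc_generator (fst c)) = ?t (fst c) (snd c)" if "c \<in> cells n" for c
  proof -
    obtain p j where c: "c = (p, j)" "1 \<le> p" "j < n p" using \<open>c \<in> cells n\<close> by (cases c) (auto simp: cells_def)
    interpret G: comm_group "cellchains p" by (rule comm_group_cellchains[OF c(2)])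
    have R: "subgroup (realizable p (Z p) (L p) origin) (cellchains p)"
      unfolding cellchains_eq[OF c(2)] by (rule subgroup_realizable[OF c(2)]) auto
    have g: "gen p i \<in> realizable p (Z p) (L p) origin" if "i < n p" for i
      unfolding realizable_def gen_eq[OF c(2)] disc_eq disc_boundary_eq
      using continuous_map_cell[OF c(2) that] cell_map_Bdry_origin[of p i]
      by (intro CollectI exI[of _ "cell_map (p, i)"]) (auto simp: image_subset_iff_funcset)
    have "?t p j \<in> realizable p (Z p) (L p) origin"
    proof (rule finprod_in_subgroup[OF G.comm_group_axioms R], rule Pi_I)
      fix i assume "i \<in> {..<n p}"
      then have "gen p i \<in> realizable p (Z p) (L p) origin" using g by simp
      then show "gen p i [^]\<^bsub>cellchains p\<^esub> A p i j \<in> realizable p (Z p) (L p) origin"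
        by (rule G.subgroup_int_pow_closed[OF R])
    qed
    then obtain \<phi> where "continuous_on (Disc p) \<phi> \<and> \<phi> ` Disc p \<subseteq> Z p \<and> \<phi> ` Bdry p \<subseteq> {origin} \<and>
        ?t p j = ?I p \<phi> (disc_generator p)"
      unfolding realizable_def by blast
    then show ?thesis unfolding c(1) by (intro exI[of _ \<phi>]) simp
  qed
  then have "\<exists>\<phi>. \<forall>c\<in>cells n. continuous_on (Disc (fst c)) (\<phi> c) \<and> \<phi> c ` Disc (fst c) \<subseteq> Z (fst c) \<and>
      \<phi> c ` Bdry (fst c) \<subseteq> {origin} \<and> ?I (fst c) (\<phi> c) (disc_generator (fst c)) = ?t (fst c) (snd c)"
    by (intro bchoice ballI)
  then obtain \<phi> where *: "\<forall>c\<in>cells n. continuous_on (Disc (fst c)) (\<phi> c) \<and> \<phi> c ` Disc (fst c) \<subseteq> Z (fst c) \<and>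
      \<phi> c ` Bdry (fst c) \<subseteq> {origin} \<and> ?I (fst c) (\<phi> c) (disc_generator (fst c)) = ?t (fst c) (snd c)"
    by (rule exE)
  have \<phi>1: "continuous_on (Disc (fst c)) (\<phi> c)" if "c \<in> cells n" for c
    by (rule conjunct1[OF bspec[OF * that]])
  have \<phi>2: "\<phi> c ` Disc (fst c) \<subseteq> Z (fst c)" if "c \<in> cells n" for c
    by (rule conjunct1[OF conjunct2[OF bspec[OF * that]]])
  have \<phi>3: "\<phi> c ` Bdry (fst c) \<subseteq> {origin}" if "c \<in> cells n" for c
    by (rule conjunct1[OF conjunct2[OF conjunct2[OF bspec[OF * that]]]])
  have \<phi>4: "?I (fst c) (\<phi> c) (disc_generator (fst c)) = ?t (fst c) (snd c)" if "c \<in> cells n" for c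
    by (rule conjunct2[OF conjunct2[OF conjunct2[OF bspec[OF * that]]]])
  define f where "f = wedge_lift origin \<phi>"
  have fc: "f (cell_map c v) = \<phi> c v" if "c \<in> cells n" "v \<in> Disc (fst c)" for c v
    unfolding f_def using that(2) \<phi>3[OF that(1)] by (rule wedge_lift_cell)
  have fZ: "f ` Z p \<subseteq> Z p" for p
  proof
    fix y assume "y \<in> f ` Z p"
    then obtain x where x: "x \<in> Z p" "y = f x" by blast
    from x(1) show "y \<in> Z p"
    proof (cases rule: wedge_cases)
      case 1 then show ?thesis by (simp add: x f_def)
    next
      case (2 c v)
      then have c: "c \<in> cells n" "fst c \<le> p" "v \<in> Disc (fst c)" by (auto simp: skel_def)
      then have "y \<in> Z (fst c)" using fc \<phi>2 2 x by fastforce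
      moreover have "skel n (fst c) \<subseteq> skel n p" using c by (auto simp: skel_def)
      ultimately show ?thesis using wedge_mono by blast
    qed
  qed
  have fcont: "continuous_on (wedge (cells n)) f"
    unfolding f_def by (rule continuous_on_wedge_lift[OF finite_cells[OF finite_dims]]) (use \<phi>1 \<phi>3 in auto)
  have fX: "f ` wedge (cells n) \<subseteq> wedge (cells n)"
  proof
    fix y assume "y \<in> f ` wedge (cells n)"
    then obtain x where x: "x \<in> wedge (cells n)" "y = f x" by blast
    from x(1) show "y \<in> wedge (cells n)"
    proof (cases rule: wedge_cases)
      case 1 then show ?thesis by (simp add: x f_def)
    next
      case (2 c v)
      then have "y \<in> Z (fst c)" using fc \<phi>2 x by fastforce
      then show ?thesis using Z_subset by blast
    qed
  qed
  show thesis
  proof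
    show "cellular_map X f" using fcont fX fZ by (simp add: cellular_map_iff)
    fix p j assume p: "1 \<le> p" and j: "j < n p"
    have c: "(p, j) \<in> cells n" using p j by (simp add: cells_def)
    have fm: "continuous_map (top_of_set (Z p)) (top_of_set (Z p)) f"
      using continuous_on_subset[OF fcont Z_subset] fZ by (simp add: image_subset_iff_funcset)
    have "cell_chain_map X p f (gen p j)
      = hom_induced (int p) (top_of_set (Disc p)) (Bdry p) (top_of_set (Z p)) (L p) (f \<circ> cell_map (p, j)) (disc_generator p)"
      unfolding chain_map_eq[OF p] gen_eq[OF p]
      by (rule hom_induced_compose'[OF continuous_map_cell[OF p j] cell_map_Bdry_wedge fm])
         (use fZ[of "p - 1"] in auto)
    also have "\<dots> = ?I p (\<phi> (p, j)) (disc_generator p)"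
      unfolding disc_eq disc_boundary_eq
      by (rule fun_cong, rule hom_induced_eq) (use fc[OF c] in auto)
    also have "\<dots> = ?t p j" using \<phi>4[OF c] by simp
    finally show "cell_chain_map X p f (gen p j) = ?t p j" .
  qed
qed

text \<open>As the attaching maps are constant, the cells come from absolute homology, which sees only the
  homotopy class of a map of the skeleton; the retraction onto the skeleton keeps the homotopy
  inside it.\<close>

lemma gen_from_absolute:
  assumes p: "1 \<le> p" and j: "j < n p"
  obtains y where "y \<in> carrier (homology_group (int p) (top_of_set (Z p)))"
    "gen p j = hom_induced (int p) (top_of_set (Z p)) {} (top_of_set (Z p)) (L p) id y"
proof -
  let ?Z = "top_of_set (Z p)"
  let ?w = "hom_induced (int p) (top_of_set (Disc p)) (Bdry p) ?Z {origin} (cell_map (p, j)) (disc_generator p)"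
  \<comment> \<open>A retraction onto the base point splits the sequence of the pair, so absolute
    homology surjects onto homology relative to that point.\<close>
  have "{origin} retract_of_space ?Z"
    unfolding retract_of_space_def by (auto intro!: exI[of _ "\<lambda>_. origin"])
  then have "hom_induced (int p) ?Z {} ?Z {origin} id ` carrier (homology_group (int p) ?Z)
      = carrier (relative_homology_group (int p) ?Z {origin})"
    by (intro epi_hom_induced_relativization) auto
  moreover have "?w \<in> carrier (relative_homology_group (int p) ?Z {origin})"
    by (rule hom_induced_carrier)
  ultimately have "?w \<in> hom_induced (int p) ?Z {} ?Z {origin} id ` carrier (homology_group (int p) ?Z)"
    by simp
  then obtain y where y: "y \<in> carrier (homology_group (int p) ?Z)" "?w = hom_induced (int p) ?Z {} ?Z {origin} id y"
    by (rule imageE)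
  have "gen p j = hom_induced (int p) (top_of_set (Disc p)) (Bdry p) ?Z (L p) (id \<circ> cell_map (p, j)) (disc_generator p)"
    by (simp add: gen_eq[OF p])
  also have "\<dots> = hom_induced (int p) ?Z {origin} ?Z (L p) id ?w"
    by (rule hom_induced_compose'[symmetric, OF continuous_map_cell[OF p j] cell_map_Bdry_origin]) auto
  also have "\<dots> = hom_induced (int p) ?Z {} ?Z (L p) (id \<circ> id) y"
    unfolding y(2) by (rule hom_induced_compose') auto
  finally show thesis using that[OF y(1)] by simp
qed

lemma chain_map_homotopic:
  assumes f: "cellular_map X f" and g: "cellular_map X g"
    and fg: "homotopic_with (\<lambda>h. True) (cw_space X) (cw_space X) f g"
    and p: "1 \<le> p" and j: "j < n p"
  shows "cell_chain_map X p f (gen p j) = cell_chain_map X p g (gen p j)"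
proof -
  let ?Z = "top_of_set (Z p)"
  obtain y where y: "y \<in> carrier (homology_group (int p) ?Z)"
    "gen p j = hom_induced (int p) ?Z {} ?Z (L p) id y"
    using gen_from_absolute[OF p j] .
  have cm: "cell_chain_map X p h (gen p j)
      = hom_induced (int p) ?Z {} ?Z (L p) id (hom_induced (int p) ?Z {} ?Z {} h y)"
    if h: "cellular_map X h" for h
  proof -
    have hm: "continuous_map ?Z ?Z h"
      using h continuous_on_subset[OF _ Z_subset] by (auto simp: cellular_map_iff image_subset_iff_funcset)
    have hL: "h \<in> L p \<rightarrow> L p" using h by (auto simp: cellular_map_iff image_subset_iff_funcset)
    have "cell_chain_map X p h (gen p j) = hom_induced (int p) ?Z {} ?Z (L p) (h \<circ> id) y"
      unfolding chain_map_eq[OF p] y(2) by (rule hom_induced_compose') (use hm hL in auto)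
    also have "\<dots> = hom_induced (int p) ?Z {} ?Z (L p) (id \<circ> h) y" by simp
    also have "\<dots> = hom_induced (int p) ?Z {} ?Z (L p) id (hom_induced (int p) ?Z {} ?Z {} h y)"
      by (rule hom_induced_compose'[symmetric]) (use hm in auto)
    finally show ?thesis .
  qed
  let ?r = "keep (skel n p)"
  have r: "continuous_map (cw_space X) ?Z ?r"
    using continuous_on_keep keep_wedge[of _ "cells n" "skel n p"] skel_subset
    by (auto simp: Int_absorb1)
  have i: "continuous_map ?Z (cw_space X) id" using Z_subset[of p] by auto
  have "homotopic_with (\<lambda>h. True) (cw_space X) ?Z (?r \<circ> f) (?r \<circ> g)"
    by (rule homotopic_with_compose_continuous_map_left[OF fg r]) simp
  then have "homotopic_with (\<lambda>h. True) ?Z ?Z (?r \<circ> f \<circ> id) (?r \<circ> g \<circ> id)"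
    by (rule homotopic_with_compose_continuous_map_right[OF _ i]) simp
  then have "hom_induced (int p) ?Z {} ?Z {} (?r \<circ> f \<circ> id) = hom_induced (int p) ?Z {} ?Z {} (?r \<circ> g \<circ> id)"
    by (rule homology_homotopy_empty)
  moreover have "hom_induced (int p) ?Z {} ?Z {} (?r \<circ> h \<circ> id) = hom_induced (int p) ?Z {} ?Z {} h"
    if "cellular_map X h" for h
  proof (rule hom_induced_eq)
    fix x assume "x \<in> topspace ?Z"
    then have "h x \<in> Z p" using that by (auto simp: cellular_map_iff image_subset_iff)
    then show "(?r \<circ> h \<circ> id) x = h x" by (simp add: keep_id)
  qed
  ultimately show ?thesis using cm f g by simp
qed

text \<open>The 0-skeleton is the one-point space \<open>disc 0\<close> and the skeleton below it is
  empty, so the chain group is literally \<open>disc_group 0\<close>. A cellular map fixes the point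
  and acts as the identity.\<close>

lemma cell_matrix_0:
  assumes "cellular_map X g" shows "cell_matrix X 0 g = 1\<^sub>m 1"
proof -
  have Z0: "skeleton X 0 = {origin}"
  proof -
    have "skel n 0 = {}" by (auto simp: skel_def cells_def)
    then show ?thesis using skeleton_wedge[of n 0] by simp
  qed
  have sub: "subtopology (cw_space X) (skeleton X (int 0)) = disc 0"
    by (simp add: Z0 subtopology_subtopology disc_eq Disc_0)
  have bd: "disc_boundary 0 = {}" by (simp add: disc_boundary_eq Bdry_0)
  have G: "cellchains 0 = disc_group 0"
    unfolding cell_chain_group_def sub by (simp add: skeleton_neg bd)
  interpret G: comm_group "disc_group 0" by simp
  note z = disc_generator_carrier[of 0]
  have top: "topspace (disc 0) = {origin}" by (simp add: disc_eq Disc_0)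
  have gen: "gen 0 i = disc_generator 0" for i
    unfolding cell_generator_def sub using z
    by (simp add: skeleton_neg bd) (rule hom_induced_id_gen, auto simp: top)
  have "g origin = origin"
    using assms Z0 unfolding cellular_map_def by (metis image_subset_iff singletonD singletonI)
  then have "continuous_map (disc 0) (disc 0) g" "\<And>x. x \<in> topspace (disc 0) \<Longrightarrow> g x = x"
    by (simp_all add: disc_eq Disc_0)
  then have cm: "cell_chain_map X 0 g (disc_generator 0) = disc_generator 0"
    unfolding cell_chain_map_def sub using z hom_induced_id_gen[of "disc 0" g "disc_generator 0" 0 "{}"]
    by (simp add: skeleton_neg bd)
  have fp: "finprod (cellchains 0) (\<lambda>i. gen 0 i [^]\<^bsub>cellchains 0\<^esub> (M i)) {..<num_cells X 0}
      = disc_generator 0 [^]\<^bsub>disc_group 0\<^esub> M 0" for M :: "nat \<Rightarrow> int"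
  proof -
    have pw: "(\<lambda>i. disc_generator 0 [^]\<^bsub>disc_group 0\<^esub> M i) \<in> A \<rightarrow> carrier (disc_group 0)" for A
      using G.int_pow_closed[OF z] by (rule Pi_I)
    have "{..<num_cells X 0} = insert 0 {}" by auto
    moreover have "finprod (disc_group 0) (\<lambda>i. disc_generator 0 [^]\<^bsub>disc_group 0\<^esub> M i) (insert 0 {})
        = disc_generator 0 [^]\<^bsub>disc_group 0\<^esub> M 0 \<otimes>\<^bsub>disc_group 0\<^esub>
          finprod (disc_group 0) (\<lambda>i. disc_generator 0 [^]\<^bsub>disc_group 0\<^esub> M i) {}"
      by (rule G.finprod_insert[OF finite.emptyI _ pw G.int_pow_closed[OF z]]) simp
    ultimately show ?thesis
      unfolding G gen by (simp only: G.finprod_empty G.r_one[OF G.int_pow_closed[OF z]])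
  qed
  show ?thesis
    unfolding cell_matrix_def
  proof (rule the_equality)
    have "disc_generator 0 [^]\<^bsub>disc_group 0\<^esub> (1::int) = disc_generator 0"
      using z by (rule G.int_pow_1)
    then show "(1\<^sub>m 1 :: int mat) \<in> carrier_mat (num_cells X 0) (num_cells X 0) \<and>
      (\<forall>j<num_cells X 0. cell_chain_map X 0 g (gen 0 j) =
        finprod (cellchains 0) (\<lambda>i. gen 0 i [^]\<^bsub>cellchains 0\<^esub> ((1\<^sub>m 1 :: int mat) $$ (i, j))) {..<num_cells X 0})"
      unfolding fp by (simp add: gen cm)
  next
    fix M :: "int mat" assume M: "M \<in> carrier_mat (num_cells X 0) (num_cells X 0) \<and>
      (\<forall>j<num_cells X 0. cell_chain_map X 0 g (gen 0 j) =
        finprod (cellchains 0) (\<lambda>i. gen 0 i [^]\<^bsub>cellchains 0\<^esub> (M $$ (i, j))) {..<num_cells X 0})"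
    then have "disc_generator 0 = disc_generator 0 [^]\<^bsub>disc_group 0\<^esub> (M $$ (0, 0))"
      unfolding fp by (simp add: gen cm)
    then have "disc_generator 0 [^]\<^bsub>disc_group 0\<^esub> (1::int) = disc_generator 0 [^]\<^bsub>disc_group 0\<^esub> (M $$ (0, 0))"
      using G.int_pow_1[OF z] by simp
    then have "M $$ (0, 0) = 1" using disc_generator_pow_inject by metis
    then show "M = 1\<^sub>m 1" using M by (intro eq_matI) auto
  qed
qed

lemma cell_matrix_pos:
  assumes p: "1 \<le> p" and M: "M \<in> carrier_mat (n p) (n p)"
    and eq: "\<And>j. j < n p \<Longrightarrow> cell_chain_map X p g (gen p j) =
      finprod (cellchains p) (\<lambda>i. gen p i [^]\<^bsub>cellchains p\<^esub> (M $$ (i, j))) {..<n p}"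
  shows "cell_matrix X p g = M"
  unfolding cell_matrix_def wedge_cw_simps(3)[OF p]
proof (rule the_equality)
  show "M \<in> carrier_mat (n p) (n p) \<and> (\<forall>j<n p. cell_chain_map X p g (gen p j) =
      finprod (cellchains p) (\<lambda>i. gen p i [^]\<^bsub>cellchains p\<^esub> (M $$ (i, j))) {..<n p})"
    using M eq by simp
next
  fix N :: "int mat" assume N: "N \<in> carrier_mat (n p) (n p) \<and> (\<forall>j<n p. cell_chain_map X p g (gen p j) =
      finprod (cellchains p) (\<lambda>i. gen p i [^]\<^bsub>cellchains p\<^esub> (N $$ (i, j))) {..<n p})"
  show "N = M"
  proof (rule eq_matI)
    fix i j assume "i < dim_row M" "j < dim_col M"
    then have ij: "i < n p" "j < n p" using M by auto
    show "N $$ (i, j) = M $$ (i, j)"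
      by (rule generators_independent[OF p ij(1), of "\<lambda>i. N $$ (i, j)" "\<lambda>i. M $$ (i, j)"])
         (simp only: eq[OF ij(2), symmetric] N[THEN conjunct2, rule_format, OF ij(2), symmetric])
  qed (use M N in auto)
qed

text \<open>The description is well defined because any competitor has exactly the same cell
  matrices as \<open>f\<close>, not just the same classes in \<open>U_Z\<close>; \<open>f\<close>
  itself witnesses existence.\<close>

lemma universal_lefschetz_eq:
  assumes f: "cellular_map X f" and M: "\<And>p. M p \<in> carrier_mat (n p) (n p)"
    and eq: "\<And>p j. 1 \<le> p \<Longrightarrow> j < n p \<Longrightarrow> cell_chain_map X p f (gen p j) =
      finprod (cellchains p) (\<lambda>i. gen p i [^]\<^bsub>cellchains p\<^esub> (M p $$ (i, j))) {..<n p}"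
  shows "universal_lefschetz X f = finprod U_Z
      (\<lambda>p. mat_class (if p = 0 then 1\<^sub>m 1 else M p) [^]\<^bsub>U_Z\<^esub> ((-1) ^ p :: int)) {p. num_cells X p \<noteq> 0}"
proof -
  have *: "cellular_lefschetz_class X g = finprod U_Z
      (\<lambda>p. mat_class (if p = 0 then 1\<^sub>m 1 else M p) [^]\<^bsub>U_Z\<^esub> ((-1) ^ p :: int)) {p. num_cells X p \<noteq> 0}"
    if g: "cellular_map X g" "homotopic_with (\<lambda>h. True) (cw_space X) (cw_space X) f g" for g
  proof -
    have "cell_matrix X p g = (if p = 0 then 1\<^sub>m 1 else M p)" for p
    proof (cases "p = 0")
      case True then show ?thesis using cell_matrix_0[OF g(1)] by simp
    next
      case False
      then have p: "1 \<le> p" by simp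
      have "cell_matrix X p g = M p"
        by (rule cell_matrix_pos[OF p M]) (simp only: chain_map_homotopic[OF f g p, symmetric] eq[OF p])
      then show ?thesis using False by simp
    qed
    then show ?thesis unfolding cellular_lefschetz_class_def by simp
  qed
  have "homotopic_with (\<lambda>h. True) (cw_space X) (cw_space X) f f"
    using f by (simp add: cellular_map_def)
  then show ?thesis
    unfolding universal_lefschetz_def by (intro the_equality exI[of _ f] conjI f *[symmetric]) (auto simp: *)
qed

end

theorem theorem4p1:
  fixes a :: "(int mat \<Rightarrow>\<^sub>0 int) set"
  assumes "a \<in> carrier U_Z"
  shows "\<exists>(X :: (nat \<Rightarrow> real) cw) (f :: (nat \<Rightarrow> real) \<Rightarrow> (nat \<Rightarrow> real)).
           finite_CW_complex X \<and> simply_connected_space (cw_space X) \<and>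
           continuous_map (cw_space X) (cw_space X) f \<and>
           universal_lefschetz X f = a"
proof -
  interpret U: comm_group U_Z by (rule comm_group_U_Z)
  obtain k m A B where AB: "k > 0" "m > 0" "A \<in> carrier_mat k k" "B \<in> carrier_mat m m"
    "a = mat_class (1\<^sub>m 1) \<otimes>\<^bsub>U_Z\<^esub> mat_class A \<otimes>\<^bsub>U_Z\<^esub> inv\<^bsub>U_Z\<^esub> mat_class B"
    using U_Z_represent[OF assms] .
  define n where "n = (\<lambda>p :: nat. if p = 2 then k else if p = 3 then m else (0::nat))"
  define M where "M = (\<lambda>p :: nat. if p = 2 then A else if p = 3 then B else (0\<^sub>m 0 0 :: int mat))"
  have dims: "{p. n p \<noteq> 0} \<subseteq> {2, 3}" by (auto simp: n_def)
  interpret sphere_wedge n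
    by unfold_locales (rule finite_subset[OF dims], simp)
  have M: "M p \<in> carrier_mat (n p) (n p)" for p using AB by (simp add: M_def n_def)
  obtain f where f: "cellular_map X f"
    "\<And>p j. 1 \<le> p \<Longrightarrow> j < n p \<Longrightarrow> cell_chain_map X p f (gen p j) =
      finprod (cellchains p) (\<lambda>i. gen p i [^]\<^bsub>cellchains p\<^esub> (M p $$ (i, j))) {..<n p}"
    using cellular_map_realization[of "\<lambda>p i j. M p $$ (i, j)"] by blast
  \<comment> \<open>Positivity of \<open>k\<close> and \<open>m\<close> makes this set independent
    of the matrices.\<close>
  have cells: "{p. num_cells X p \<noteq> 0} = {0, 2, 3}"
    using AB(1,2) by (auto simp: wedge_cw_def n_def split: if_splits)
  have c: "mat_class (1\<^sub>m 1) \<in> carrier U_Z" "mat_class A \<in> carrier U_Z" "mat_class B \<in> carrier U_Z"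
    using mat_class_carrier[of "1\<^sub>m 1" 1] mat_class_carrier[OF AB(3)] mat_class_carrier[OF AB(4)] by simp_all
  have "universal_lefschetz X f = finprod U_Z
      (\<lambda>p. mat_class (if p = 0 then 1\<^sub>m 1 else M p) [^]\<^bsub>U_Z\<^esub> ((-1) ^ p :: int)) {0, 2, 3}"
    unfolding cells[symmetric] by (rule universal_lefschetz_eq[OF f(1) M f(2)])
  also have "\<dots> = mat_class (1\<^sub>m 1) \<otimes>\<^bsub>U_Z\<^esub> (mat_class A \<otimes>\<^bsub>U_Z\<^esub> inv\<^bsub>U_Z\<^esub> mat_class B)"
    \<comment> \<open>Degrees 0 and 2 enter with exponent 1, degree 3 with exponent -1.\<close>
    using c U.int_pow_neg[of "mat_class B" 1] by (simp add: M_def U.int_pow_1)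
  also have "\<dots> = a" using c AB(5) by (simp add: U.m_assoc)
  finally have "universal_lefschetz X f = a" .
  moreover have "finite_CW_complex X" by (rule finite_CW_complex_wedge[OF finite_dims])
  moreover have "simply_connected_space (cw_space X)"
  proof -
    have "2 \<le> fst c" if "c \<in> cells n" for c
      using that by (auto simp: cells_def n_def split: if_splits)
    then show ?thesis
      using simply_connected_space_wedge[OF finite_cells[OF finite_dims]] by simp
  qed
  moreover have "continuous_map (cw_space X) (cw_space X) f" using f(1) by (simp add: cellular_map_def)
  ultimately show ?thesis by blast
qed

end
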